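(* Let $\mu$ be a probability distribution on $\mathbb{R}^{d\times d}$ with compact support, let $\mathcal{M}=\operatorname{supp}\mu$, and let $A$ be a random matrix with distribution $\mu$. Assume that the singular part $\mu_s$ of $\mu$ consists of only point measures, i.e. $\mu_s=\sum_{i=1}^N p_i\delta_{M_i}$ for some positive numbers $p_1,\dots,p_N$ and matrices $M_1,\dots,M_N$. Then $$\hat\rho(\mathcal{M})=\limsup_{p\to\infty}\left(\rho(E[A^{\otimes p}])\right)^{1/p}.$$
   Context: $p$ ranges over positive integers. $\rho(\cdot)$ is the spectral radius of a square matrix and $A^{\otimes p}\in\mathbb{R}^{d^p\times d^p}$ is the $p$-fold Kronecker power of $A$. The joint spectral radius of $\mathcal{M}\subset\mathbb{R}^{d\times d}$ is $$\hat\rho(\mathcal{M}):=\limsup_{k\to\infty}\sup_{A_1,\dots,A_k\in\mathcal{M}}\|A_k\cdots A_1\|^{1/k},$$ which is independent of the norm $\|\cdot\|$ on $\mathbb{R}^{d\times d}$. The singular part $\mu_s$ is that of the Lebesgue decomposition of $\mu$ with respect to Lebesgue measure on $\mathbb{R}^{d\times d}$; the case $\mu_s=0$ ($N=0$) is allowed. $\delta_M$ is the Dirac measure at $M$. *)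

theory Defs
  imports "HOL-Probability.Probability" "Jordan_Normal_Form.Spectral_Radius"
begin

no_notation Matrix.vec_index (infixl \<open>$\<close> 100)

definition measure_support :: "'a::topological_space measure \<Rightarrow> 'a set" where
  "measure_support \<mu> = {x. \<forall>U. open U \<and> x \<in> U \<longrightarrow> emeasure \<mu> U > 0}"

definition mutually_singular :: "'a measure \<Rightarrow> 'a measure \<Rightarrow> bool" where
  "mutually_singular M N \<longleftrightarrow> sets M = sets N \<and>
     (\<exists>S\<in>sets M. emeasure M S = 0 \<and> emeasure N (space N - S) = 0)"

definition lebesgue_decomposition ::
    "'a measure \<Rightarrow> 'a measure \<Rightarrow> 'a measure \<Rightarrow> 'a measure \<Rightarrow> bool" where
  "lebesgue_decomposition \<nu> \<mu> \<mu>\<^sub>a \<mu>\<^sub>s \<longleftrightarrow>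
     sets \<mu> = sets \<nu> \<and> sets \<mu>\<^sub>a = sets \<nu> \<and> sets \<mu>\<^sub>s = sets \<nu> \<and>
     (\<forall>B\<in>sets \<nu>. emeasure \<mu> B = emeasure \<mu>\<^sub>a B + emeasure \<mu>\<^sub>s B) \<and>
     absolutely_continuous \<nu> \<mu>\<^sub>a \<and> mutually_singular \<nu> \<mu>\<^sub>s"

fun matrix_word :: "(nat \<Rightarrow> real^'n^'n) \<Rightarrow> nat \<Rightarrow> real^'n^'n" where
  "matrix_word A 0 = Finite_Cartesian_Product.mat 1"
| "matrix_word A (Suc k) = A (Suc k) ** matrix_word A k"

(* norm is the Euclidean (Frobenius) norm of real^'n^'n; root k x stands for x^(1/k).
   Suprema and upper limits are taken in ereal, where they always exist. *)
definition joint_spectral_radius :: "(real^'n^'n) set \<Rightarrow> ereal" where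
  "joint_spectral_radius \<M> =
     limsup (\<lambda>k. SUP A\<in>{A. \<forall>i\<in>{1..k}. A i \<in> \<M>}. ereal (root k (norm (matrix_word A k))))"

(* Numbers the index type by {..<CARD('n)}, so that Kronecker powers of all orders live in
   one type. Another numbering permutes rows and columns simultaneously. *)
definition to_mat :: "real^'n^'n \<Rightarrow> real mat" where
  "to_mat A = Matrix.mat CARD('n) CARD('n)
     (\<lambda>(i, j). A $ from_nat_into UNIV i $ from_nat_into UNIV j)"

definition kronecker_product :: "'a::times mat \<Rightarrow> 'a mat \<Rightarrow> 'a mat" where
  "kronecker_product A B = Matrix.mat (dim_row A * dim_row B) (dim_col A * dim_col B)
     (\<lambda>(i, j). A $$ (i div dim_row B, j div dim_col B) * B $$ (i mod dim_row B, j mod dim_col B))"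

fun kronecker_power :: "'a::semiring_1 mat \<Rightarrow> nat \<Rightarrow> 'a mat" where
  "kronecker_power A 0 = 1\<^sub>m 1"
| "kronecker_power A (Suc p) = kronecker_product A (kronecker_power A p)"

definition expected_kronecker_power ::
    "'w measure \<Rightarrow> ('w \<Rightarrow> real^'n^'n) \<Rightarrow> nat \<Rightarrow> real mat" where
  "expected_kronecker_power P A p = Matrix.mat (CARD('n) ^ p) (CARD('n) ^ p)
     (\<lambda>(i, j). \<integral>\<omega>. kronecker_power (to_mat (A \<omega>)) p $$ (i, j) \<partial>P)"

end

theory Submission
  imports Defs
begin

text \<open>Write \<open>r\<close> for the upper limit on the right and let \<open>A\<close> have law \<open>\<mu>\<close>, supported by \<open>\<M>\<close>.

That \<open>r\<close> is at most the joint spectral radius is elementary. A left eigenvector of the mean of the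
\<open>p\<close>-th Kronecker power, with eigenvalue \<open>e\<close>, is a \<open>p\<close>-linear form that averaging over \<open>A\<close> multiplies
by \<open>e\<close>. Averaging \<open>k\<close> times brings in products of \<open>k\<close> matrices from \<open>\<M>\<close>, so if these have norm at most
\<open>s^k\<close> for large \<open>k\<close>, then \<open>cmod e \<le> s^p\<close> (\<open>eigenvalue_le\<close>).

For the converse let \<open>s > r\<close>. For large even \<open>p\<close> the spectral bound turns the form \<open>\<Sum>a. x\<^sub>a^p\<close>, by
averaging it over finitely many independent factors and summing, into a convex positive form \<open>f\<close> of degree
\<open>p\<close> whose average \<open>E f(A x)\<close> is at most \<open>s^p f(x)\<close>. Convexity and homogeneity make its \<open>p\<close>-th root a
norm \<open>N\<^sub>p\<close> (\<open>averaged_norm\<close>). Averaging bounds the expansion of \<open>N\<^sub>p\<close> by \<open>s\<close> only in the mean of order \<open>p\<close>, but a mean of large order is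
almost a maximum: near each matrix in the support there are matrices that expand \<open>N\<^sub>p\<close> by hardly more than
\<open>s\<close> (\<open>averaged_norms_approximate\<close>). Normalised on an invariant subspace, the \<open>N\<^sub>p\<close> are equicontinuous,
and their pointwise upper limit is a nonzero seminorm that every matrix of \<open>\<M>\<close> expands at most by \<open>s\<close>
(\<open>limit_seminorm\<close>).

This limit may vanish on a proper subspace, which is then again invariant. Starting over there, with the same
norms normalised anew, and gluing the results gives by induction on the dimension a gauge comparable with
the Euclidean norm that \<open>\<M>\<close> expands by at most any given number above \<open>s\<close>
(\<open>invariant_subspace_gauge\<close>). Such a gauge bounds all products of matrices from \<open>\<M>\<close>, hence the joint
spectral radius.\<close>

section \<open>Upper limits of bounded real sequences\<close>

text \<open>Taken as a real number, so that pointwise upper limits of seminorms are again real functions; on sequences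
that are not bounded the value is meaningless.\<close>

definition upper_limit :: "(nat \<Rightarrow> real) \<Rightarrow> real" where
  "upper_limit a = real_of_ereal (limsup (\<lambda>k. ereal (a k)))"

lemma ereal_upper_limit:
  assumes "\<And>k. \<bar>a k\<bar> \<le> B"
  shows "limsup (\<lambda>k. ereal (a k)) = ereal (upper_limit a)"
proof -
  have *: "a k \<le> B" "- B \<le> a k" for k using assms[of k] by linarith+
  have "limsup (\<lambda>k. ereal (a k)) \<le> ereal B"
    by (rule Limsup_bounded) (simp add: *)
  moreover have "ereal (- B) \<le> limsup (\<lambda>k. ereal (a k))"
    by (rule le_Limsup) (simp_all add: *)
  ultimately show ?thesis unfolding upper_limit_def
    by (cases "limsup (\<lambda>k. ereal (a k))") auto
qed

lemma upper_limit_mono: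
  assumes "\<And>k. \<bar>a k\<bar> \<le> B" "\<And>k. \<bar>b k\<bar> \<le> C" "eventually (\<lambda>k. a k \<le> b k) sequentially"
  shows "upper_limit a \<le> upper_limit b"
proof -
  have "limsup (\<lambda>k. ereal (a k)) \<le> limsup (\<lambda>k. ereal (b k))"
    by (rule Limsup_mono) (use assms(3) in simp)
  then show ?thesis
    by (simp only: ereal_upper_limit[of a, OF assms(1)] ereal_upper_limit[of b, OF assms(2)] ereal_less_eq)
qed

lemma upper_limit_add:
  assumes "\<And>k. \<bar>a k\<bar> \<le> B" "\<And>k. \<bar>b k\<bar> \<le> C"
  shows "upper_limit (\<lambda>k. a k + b k) \<le> upper_limit a + upper_limit b"
proof -
  have "\<bar>a k + b k\<bar> \<le> B + C" for k using assms(1)[of k] assms(2)[of k] by linarith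
  then have "ereal (upper_limit (\<lambda>k. a k + b k)) = limsup (\<lambda>k. ereal (a k) + ereal (b k))"
    by (subst ereal_upper_limit[symmetric]) auto
  also have "\<dots> \<le> limsup (\<lambda>k. ereal (a k)) + limsup (\<lambda>k. ereal (b k))"
    by (rule ereal_limsup_add_mono)
  also have "\<dots> = ereal (upper_limit a + upper_limit b)"
    by (simp add: ereal_upper_limit[of a, OF assms(1)] ereal_upper_limit[of b, OF assms(2)])
  finally show ?thesis by (simp only: ereal_less_eq)
qed

lemma upper_limit_const [simp]: "upper_limit (\<lambda>k. c) = c"
  by (simp add: upper_limit_def Limsup_const)

lemma upper_limit_cmult:
  assumes "\<And>k. \<bar>a k\<bar> \<le> B" "c \<ge> 0"
  shows "upper_limit (\<lambda>k. c * a k) = c * upper_limit a"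
proof -
  have "limsup (\<lambda>k. ereal c * ereal (a k)) = ereal c * limsup (\<lambda>k. ereal (a k))"
    by (rule limsup_ereal_mult_left) (simp_all add: \<open>c \<ge> 0\<close>)
  then show ?thesis
    by (simp add: upper_limit_def[of "\<lambda>k. c * a k"] ereal_upper_limit[of a, OF assms(1)])
qed

lemma upper_limit_ge_frequently:
  assumes "\<And>k. \<bar>a k\<bar> \<le> B" "\<exists>\<^sub>F k in sequentially. c \<le> a k"
  shows "c \<le> upper_limit a"
proof (rule ccontr)
  assume "\<not> c \<le> upper_limit a"
  then have "limsup (\<lambda>k. ereal (a k)) < ereal c"
    by (simp add: ereal_upper_limit[of a, OF assms(1)])
  then have "eventually (\<lambda>k. ereal (a k) < ereal c) sequentially"
    by (rule Limsup_lessD)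
  then show False using assms(2) by (auto simp: frequently_def not_le)
qed

section \<open>Seminorms on Euclidean spaces\<close>

definition seminorm :: "('a::real_vector \<Rightarrow> real) \<Rightarrow> bool" where
  "seminorm N \<longleftrightarrow> (\<forall>x y. N (x + y) \<le> N x + N y) \<and> (\<forall>c x. N (c *\<^sub>R x) = \<bar>c\<bar> * N x)"

lemma seminorm_add: "seminorm N \<Longrightarrow> N (x + y) \<le> N x + N y"
  and seminorm_scale: "seminorm N \<Longrightarrow> N (c *\<^sub>R x) = \<bar>c\<bar> * N x"
  unfolding seminorm_def by blast+

lemma seminorm_zero: "seminorm N \<Longrightarrow> N 0 = 0"
  using seminorm_scale[of N 0 0] by simp

lemma seminorm_minus: "seminorm N \<Longrightarrow> N (- x) = N x"
  using seminorm_scale[of N "-1" x] by simp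

lemma seminorm_nonneg: assumes "seminorm N" shows "0 \<le> N x"
  using seminorm_add[OF assms, of x "-x"] seminorm_minus[OF assms, of x] seminorm_zero[OF assms] by simp

lemma seminorm_diff:
  assumes "seminorm N" shows "\<bar>N x - N y\<bar> \<le> N (x - y)"
proof -
  have "N (y - x) = N (x - y)" using seminorm_minus[OF assms, of "x - y"] by simp
  moreover have "N x \<le> N (x - y) + N y" using seminorm_add[OF assms, of "x - y" y] by simp
  moreover have "N y \<le> N (y - x) + N x" using seminorm_add[OF assms, of "y - x" x] by simp
  ultimately show ?thesis by linarith
qed

lemma seminorm_sum_le:
  assumes "finite S" "seminorm N"
  shows "N (sum f S) \<le> (\<Sum>i\<in>S. N (f i))"
  using assms
proof (induction S rule: finite_induct)
  case empty then show ?case by (simp add: seminorm_zero)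
next
  case (insert i S) then show ?case using seminorm_add[of N "f i" "sum f S"] by auto
qed

lemma seminorm_bounded:
  fixes N :: "'a::euclidean_space \<Rightarrow> real"
  assumes "seminorm N"
  shows "N x \<le> (\<Sum>b\<in>Basis. N b) * norm x"
proof -
  have "N x = N (\<Sum>b\<in>Basis. (inner x b) *\<^sub>R b)" by (simp add: euclidean_representation)
  also have "\<dots> \<le> (\<Sum>b\<in>Basis. N ((inner x b) *\<^sub>R b))"
    by (rule seminorm_sum_le[OF _ assms]) simp
  also have "\<dots> \<le> (\<Sum>b\<in>Basis. N b * norm x)"
    by (rule sum_mono)
      (simp add: seminorm_scale[OF assms] mult.commute mult_left_mono Basis_le_norm seminorm_nonneg[OF assms])
  finally show ?thesis by (simp add: sum_distrib_right)
qed

lemma lipschitz_continuous_on: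
  fixes f :: "'a::real_normed_vector \<Rightarrow> real"
  assumes "\<And>x y. x \<in> S \<Longrightarrow> y \<in> S \<Longrightarrow> \<bar>f x - f y\<bar> \<le> B * norm (x - y)"
  shows "continuous_on S f"
proof -
  have "(max B 0)-lipschitz_on S f"
  proof (rule lipschitz_onI)
    fix x y assume "x \<in> S" "y \<in> S"
    then have "\<bar>f x - f y\<bar> \<le> B * norm (x - y)" by (rule assms)
    also have "\<dots> \<le> max B 0 * norm (x - y)" by (intro mult_right_mono) auto
    finally show "dist (f x) (f y) \<le> max B 0 * dist x y" by (simp add: dist_norm)
  qed auto
  then show ?thesis by (rule lipschitz_on_continuous_on)
qed

lemma seminorm_continuous:
  fixes N :: "'a::euclidean_space \<Rightarrow> real"
  assumes "seminorm N" shows "continuous_on S N"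
proof (rule lipschitz_continuous_on)
  fix x y :: 'a
  show "\<bar>N x - N y\<bar> \<le> (\<Sum>b\<in>Basis. N b) * norm (x - y)"
    using seminorm_diff[OF assms, of x y] seminorm_bounded[OF assms, of "x - y"] by linarith
qed

lemma norm_matrix_vector_le:
  fixes A :: "real^'n^'m"
  shows "norm (A *v x) \<le> norm A * norm x"
proof -
  have "norm (A *v x) \<le> L2_set (\<lambda>i. norm (A $ i) * norm x) UNIV"
    unfolding norm_vec_def[of "A *v x"]
    by (rule L2_set_mono) (auto simp: matrix_vector_mul_component Cauchy_Schwarz_ineq2)
  also have "\<dots> = norm A * norm x"
    by (simp add: norm_vec_def[of A] L2_set_left_distrib)
  finally show ?thesis .
qed

lemma seminorm_normalize:
  fixes N :: "'a::euclidean_space \<Rightarrow> real"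
  assumes N: "seminorm N" and pos: "\<And>x. x \<noteq> 0 \<Longrightarrow> 0 < N x"
    and V: "Real_Vector_Spaces.subspace V" "V \<noteq> {0}"
  shows "\<exists>c u. 0 < c \<and> u \<in> V \<and> norm u = 1 \<and> N u / c = 1 \<and> (\<forall>x\<in>V. N x / c \<le> norm x)"
proof -
  let ?S = "V \<inter> sphere 0 1"
  have "compact ?S"
    using closed_subspace[OF V(1)] by (intro closed_Int_compact) auto
  moreover obtain y where y: "y \<in> V" "y \<noteq> 0" using V subspace_0 by blast
  moreover have "y /\<^sub>R norm y \<in> ?S" using y subspace_scale[OF V(1)] by simp
  then have "?S \<noteq> {}" by blast
  ultimately obtain u where u: "u \<in> ?S" "\<And>x. x \<in> ?S \<Longrightarrow> N x \<le> N u"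
    using continuous_attains_sup[OF _ _ seminorm_continuous[OF N], of ?S] by blast
  have "u \<noteq> 0" using u(1) by auto
  have "N x / N u \<le> norm x" if "x \<in> V" for x
  proof (cases "x = 0")
    case True then show ?thesis using seminorm_zero[OF N] by simp
  next
    case False
    have "x /\<^sub>R norm x \<in> ?S" using False that subspace_scale[OF V(1)] by simp
    then have "N (x /\<^sub>R norm x) \<le> N u" by (rule u(2))
    then have "N x / norm x \<le> N u"
      using seminorm_scale[OF N, of "inverse (norm x)" x] by (simp add: divide_inverse mult.commute)
    then show ?thesis using False pos[OF \<open>u \<noteq> 0\<close>] by (simp add: field_simps)
  qed
  moreover have "u \<in> V" "norm u = 1" using u(1) by auto
  ultimately show ?thesis using pos[OF \<open>u \<noteq> 0\<close>]
    by (intro exI[of _ "N u"] exI[of _ u]) simp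
qed

text \<open>Compactness of the unit sphere of \<open>Z\<close>. The set \<open>Z\<close> may be the zero space, where any constant serves.\<close>

lemma positive_homogeneous_lower_bound:
  fixes v :: "'a::euclidean_space \<Rightarrow> real"
  assumes Z: "Real_Vector_Spaces.subspace Z" and cont: "continuous_on Z v"
    and hom: "\<And>c x. x \<in> Z \<Longrightarrow> v (c *\<^sub>R x) = \<bar>c\<bar> * v x"
    and pos: "\<And>x. x \<in> Z \<Longrightarrow> x \<noteq> 0 \<Longrightarrow> 0 < v x"
  obtains m where "0 < m" "\<And>x. x \<in> Z \<Longrightarrow> m * norm x \<le> v x"
proof -
  let ?S = "Z \<inter> sphere 0 1"
  have S: "compact ?S" using closed_subspace[OF Z] by (intro closed_Int_compact) auto
  have "\<exists>m>0. \<forall>x\<in>?S. m \<le> v x"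
  proof (cases "?S = {}")
    case True then show ?thesis by (intro exI[of _ 1]) auto
  next
    case False
    have "continuous_on ?S v" by (rule continuous_on_subset[OF cont]) auto
    then obtain u where "u \<in> ?S" "\<And>x. x \<in> ?S \<Longrightarrow> v u \<le> v x"
      using continuous_attains_inf[OF S False] by blast
    moreover have "0 < v u" using pos[of u] \<open>u \<in> ?S\<close> by fastforce
    ultimately show ?thesis by blast
  qed
  then obtain m where m: "0 < m" "\<And>x. x \<in> ?S \<Longrightarrow> m \<le> v x" by blast
  have "m * norm x \<le> v x" if "x \<in> Z" for x
  proof (cases "x = 0")
    case True then show ?thesis using hom[OF that, of 0] by simp
  next
    case False
    have "x /\<^sub>R norm x \<in> ?S" using False that subspace_scale[OF Z] by simp
    then have "m \<le> v (x /\<^sub>R norm x)" by (rule m(2))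
    also have "\<dots> = v x / norm x" using hom[OF that, of "inverse (norm x)"]
      by (simp add: divide_inverse mult.commute)
    finally show ?thesis using False by (simp add: field_simps)
  qed
  with m(1) show ?thesis by (rule that)
qed

section \<open>Gauges on invariant subspaces\<close>

text \<open>Each \<open>N k\<close> is divided by its maximum over the unit sphere of \<open>V\<close>; the quotients \<open>w k\<close> are then bounded by the
norm on \<open>V\<close> and thus have Lipschitz constant 1 there. This uniform modulus does two things. It transfers the
bound from a nearby \<open>A'\<close> to \<open>A\<close> itself at a cost of \<open>d * norm x\<close>, and it keeps the limit from vanishing: at
an accumulation point of the maximisers \<open>u k\<close> the values \<open>w k\<close> stay near 1 along a subsequence.\<close>

lemma limit_seminorm:
  fixes N :: "nat \<Rightarrow> real^'n \<Rightarrow> real" and M :: "(real^'n^'n) set"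
  assumes N: "\<And>k. seminorm (N k)" and pos: "\<And>k x. x \<noteq> 0 \<Longrightarrow> 0 < N k x"
    and V: "Real_Vector_Spaces.subspace V" "V \<noteq> {0}"
    and inv: "\<And>A x. A \<in> M \<Longrightarrow> x \<in> V \<Longrightarrow> A *v x \<in> V"
    and r: "0 \<le> r"
    and approx: "\<And>A d. A \<in> M \<Longrightarrow> 0 < d \<Longrightarrow> eventually (\<lambda>k. \<forall>x. \<exists>A'\<in>M.
        norm (A - A') < d \<and> N k (A' *v x) \<le> (r + d) * N k x) sequentially"
  obtains v where "\<And>x. x \<in> V \<Longrightarrow> 0 \<le> v x" "\<And>x. x \<in> V \<Longrightarrow> v x \<le> norm x"
    "\<And>x y. x \<in> V \<Longrightarrow> y \<in> V \<Longrightarrow> v (x + y) \<le> v x + v y"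
    "\<And>c x. x \<in> V \<Longrightarrow> v (c *\<^sub>R x) = \<bar>c\<bar> * v x"
    "\<exists>u\<in>V. 0 < v u" "\<And>A x. A \<in> M \<Longrightarrow> x \<in> V \<Longrightarrow> v (A *v x) \<le> r * v x"
proof -
  have "\<forall>k. \<exists>c u. 0 < c \<and> u \<in> V \<and> norm u = 1 \<and> N k u / c = 1 \<and> (\<forall>x\<in>V. N k x / c \<le> norm x)"
    using seminorm_normalize[OF N pos V] by blast
  then obtain c u where cu: "\<And>k. 0 < c k" "\<And>k. u k \<in> V" "\<And>k. norm (u k) = 1"
      "\<And>k. N k (u k) / c k = 1" "\<And>k x. x \<in> V \<Longrightarrow> N k x / c k \<le> norm x"
    by metis
  define w where "w k x = N k x / c k" for k x
  have w: "seminorm (w k)" for k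
    using N[of k] cu(1)[of k] unfolding seminorm_def w_def
    by (auto simp: divide_right_mono add_divide_distrib[symmetric])
  have w_le: "\<bar>w k x\<bar> \<le> norm x" if "x \<in> V" for k x
    using seminorm_nonneg[OF w, of k x] cu(5)[OF that, of k] by (simp add: w_def)
  define v where "v x = upper_limit (\<lambda>k. w k x)" for x
  have v_nonneg: "0 \<le> v x" if "x \<in> V" for x
    using upper_limit_mono[of "\<lambda>_. 0" 0, OF _ w_le[OF that]] seminorm_nonneg[OF w, of _ x]
    by (simp add: v_def)
  have v_le: "v x \<le> norm x" if "x \<in> V" for x
    using upper_limit_mono[OF w_le[OF that], of "\<lambda>_. norm x" "norm x"] w_le[OF that]
    by (simp add: v_def abs_le_iff)
  have v_add: "v (x + y) \<le> v x + v y" if "x \<in> V" "y \<in> V" for x y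
  proof -
    have "x + y \<in> V" using that V(1) subspace_add by blast
    have *: "\<bar>w k x + w k y\<bar> \<le> norm x + norm y" for k
      using w_le[OF that(1), of k] w_le[OF that(2), of k] by linarith
    have "v (x + y) \<le> upper_limit (\<lambda>k. w k x + w k y)"
      unfolding v_def
      by (rule upper_limit_mono[OF w_le[OF \<open>x + y \<in> V\<close>] *]) (simp add: seminorm_add[OF w])
    also have "\<dots> \<le> v x + v y"
      unfolding v_def by (rule upper_limit_add[OF w_le w_le]) (use that in auto)
    finally show ?thesis .
  qed
  have v_scale: "v (a *\<^sub>R x) = \<bar>a\<bar> * v x" if "x \<in> V" for a x
    unfolding v_def seminorm_scale[OF w]
    by (rule upper_limit_cmult[OF w_le[OF that]]) simp
  have v_pos: "\<exists>l\<in>V. 0 < v l"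
  proof -
    have "compact (V \<inter> sphere 0 1)"
      using closed_subspace[OF V(1)] by (intro closed_Int_compact) auto
    moreover have "\<forall>k. u k \<in> V \<inter> sphere 0 1" using cu by simp
    ultimately obtain l \<phi> where l: "l \<in> V" "strict_mono \<phi>" "(u \<circ> \<phi>) \<longlonglongrightarrow> l"
      unfolding compact_def by blast
    have "\<exists>\<^sub>F k in sequentially. 1/2 \<le> w k l"
    proof (rule ccontr)
      assume "\<not> (\<exists>\<^sub>F k in sequentially. 1/2 \<le> w k l)"
      then have "eventually (\<lambda>k. w k l < 1/2) sequentially"
        by (simp add: not_frequently not_le)
      then have "eventually (\<lambda>j. w (\<phi> j) l < 1/2) sequentially"
        by (rule eventually_subseq[OF l(2)])
      moreover have "eventually (\<lambda>j. dist ((u \<circ> \<phi>) j) l < 1/2) sequentially"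
        using l(3) by (rule tendstoD) simp
      ultimately have "eventually (\<lambda>j. False) sequentially"
      proof eventually_elim
        case (elim j)
        have "u (\<phi> j) - l \<in> V" using cu(2) l(1) V(1) subspace_diff by blast
        then have "w (\<phi> j) (u (\<phi> j) - l) < 1/2"
          using w_le[of "u (\<phi> j) - l" "\<phi> j"] elim(2) by (simp add: dist_norm)
        moreover have "w (\<phi> j) (u (\<phi> j)) = 1" using cu(4)[of "\<phi> j"] by (simp only: w_def)
        moreover have "w (\<phi> j) (u (\<phi> j)) \<le> w (\<phi> j) (u (\<phi> j) - l) + w (\<phi> j) l"
          using seminorm_add[OF w, of "\<phi> j" "u (\<phi> j) - l" l] by simp
        ultimately show False using elim(1) by linarith
      qed
      then show False by simp
    qed
    then have "1/2 \<le> v l" unfolding v_def by (rule upper_limit_ge_frequently[OF w_le[OF l(1)]])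
    with l(1) show ?thesis by (intro bexI[of _ l]) auto
  qed
  have v_inv: "v (A *v x) \<le> r * v x" if A: "A \<in> M" and x: "x \<in> V" for A x
  proof (rule field_le_epsilon)
    fix e :: real assume "0 < e"
    define d where "d = e / (2 * norm x + 1)"
    have "0 < 2 * norm x + 1" using norm_ge_zero[of x] by linarith
    then have d: "0 < d" "2 * d * norm x \<le> e"
      using \<open>0 < e\<close> by (auto simp: d_def field_simps)
    have Ax: "A *v x \<in> V" by (rule inv[OF A x])
    have ev: "eventually (\<lambda>k. w k (A *v x) \<le> r * w k x + e) sequentially"
      using approx[OF A d(1)]
    proof eventually_elim
      case (elim k)
      then obtain A' where A': "A' \<in> M" "norm (A - A') < d" "N k (A' *v x) \<le> (r + d) * N k x"
        by blast
      have 1: "w k (A' *v x) \<le> (r + d) * w k x"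
        using divide_right_mono[OF A'(3), of "c k"] cu(1)[of k] by (simp add: w_def)
      have "A *v x - A' *v x \<in> V" using Ax inv[OF A'(1) x] V(1) subspace_diff by blast
      then have "w k (A *v x - A' *v x) \<le> norm ((A - A') *v x)"
        using w_le[of "A *v x - A' *v x" k] by (simp add: matrix_vector_mult_diff_rdistrib)
      also have "\<dots> \<le> norm (A - A') * norm x" by (rule norm_matrix_vector_le)
      also have "\<dots> \<le> d * norm x" using A'(2) by (intro mult_right_mono) auto
      finally have 2: "w k (A *v x - A' *v x) \<le> d * norm x" .
      have 3: "w k (A *v x) \<le> w k (A *v x - A' *v x) + w k (A' *v x)"
        using seminorm_add[OF w, of k "A *v x - A' *v x" "A' *v x"] by simp
      have "d * w k x \<le> d * norm x"
        using w_le[OF x, of k] d(1) by (intro mult_left_mono) auto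
      with 1 2 3 d(2) show ?case by (simp add: algebra_simps)
    qed
    have rw: "\<bar>r * w k x\<bar> \<le> r * norm x" for k
      using w_le[OF x, of k] r by (simp add: abs_mult mult_left_mono)
    have rwe: "\<bar>r * w k x + e\<bar> \<le> r * norm x + e" for k
      using rw[of k] \<open>0 < e\<close> by linarith
    have "v (A *v x) \<le> upper_limit (\<lambda>k. r * w k x + e)"
      unfolding v_def by (rule upper_limit_mono[OF w_le[OF Ax] rwe ev])
    also have "\<dots> \<le> upper_limit (\<lambda>k. r * w k x) + upper_limit (\<lambda>k. e)"
      by (rule upper_limit_add[OF rw order_refl])
    also have "\<dots> = r * v x + e"
      unfolding v_def using upper_limit_cmult[OF w_le[OF x] r] by simp
    finally show "v (A *v x) \<le> r * v x + e" .
  qed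
  show ?thesis using that[of v] v_nonneg v_le v_add v_scale v_pos v_inv by blast
qed

text \<open>Induction on the dimension of \<open>V\<close>. The kernel \<open>K\<close> of the limiting seminorm \<open>v\<close> on \<open>V\<close> is invariant and
smaller than \<open>V\<close>, so it carries a gauge \<open>g\<close>. With a linear projection \<open>P\<close> onto \<open>K\<close>, the sum \<open>g (P x) + D * v x\<close> is
comparable with the norm on \<open>V\<close>. Relative to the splitting by \<open>P\<close> the matrices of \<open>M\<close> are block triangular: the
diagonal blocks expand \<open>g\<close> by \<open>s\<close> and \<open>v\<close> by \<open>r < s\<close>, and a large weight \<open>D\<close> lets the gap \<open>s - r\<close> absorb the
off-diagonal block, which is bounded because \<open>M\<close> is.\<close>

lemma invariant_subspace_gauge:
  fixes N :: "nat \<Rightarrow> real^'n \<Rightarrow> real" and M :: "(real^'n^'n) set"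
  assumes N: "\<And>k. seminorm (N k)" and pos: "\<And>k x. x \<noteq> 0 \<Longrightarrow> 0 < N k x"
    and bdd: "\<And>A. A \<in> M \<Longrightarrow> norm A \<le> B"
    and r: "0 \<le> r" "r < s"
    and approx: "\<And>A d. A \<in> M \<Longrightarrow> 0 < d \<Longrightarrow> eventually (\<lambda>k. \<forall>x. \<exists>A'\<in>M.
        norm (A - A') < d \<and> N k (A' *v x) \<le> (r + d) * N k x) sequentially"
    and "Real_Vector_Spaces.subspace V" and "\<And>A x. A \<in> M \<Longrightarrow> x \<in> V \<Longrightarrow> A *v x \<in> V"
  shows "\<exists>g c C. 0 < c \<and> (\<forall>x\<in>V. c * norm x \<le> g x \<and> g x \<le> C * norm x) \<and>
    (\<forall>x\<in>V. \<forall>y\<in>V. g (x + y) \<le> g x + g y) \<and> (\<forall>A\<in>M. \<forall>x\<in>V. g (A *v x) \<le> s * g x)"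
  using assms(7,8)
proof (induction "dim V" arbitrary: V rule: less_induct)
  case less
  note V = less.prems(1) and inv = less.prems(2)
  show ?case
  proof (cases "V = {0}")
    case True
    then show ?thesis
      by (intro exI[of _ norm] exI[of _ 1]) auto
  next
    case False
    obtain v where v: "\<And>x. x \<in> V \<Longrightarrow> 0 \<le> v x" "\<And>x. x \<in> V \<Longrightarrow> v x \<le> norm x"
      and v_add: "\<And>x y. x \<in> V \<Longrightarrow> y \<in> V \<Longrightarrow> v (x + y) \<le> v x + v y"
      and v_scale: "\<And>c x. x \<in> V \<Longrightarrow> v (c *\<^sub>R x) = \<bar>c\<bar> * v x"
      and v_pos: "\<exists>u\<in>V. 0 < v u"
      and v_inv: "\<And>A x. A \<in> M \<Longrightarrow> x \<in> V \<Longrightarrow> v (A *v x) \<le> r * v x"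
      using limit_seminorm[OF N pos V False inv r(1) approx] by blast
    define K where "K = {x\<in>V. v x = 0}"
    have v0: "v 0 = 0" using v_scale[of 0 0] subspace_0[OF V] by simp
    have K: "Real_Vector_Spaces.subspace K"
    proof (rule subspaceI)
      show "0 \<in> K" using subspace_0[OF V] v0 by (simp add: K_def)
      show "x + y \<in> K" if "x \<in> K" "y \<in> K" for x y
        using that v_add[of x y] v(1)[of "x + y"] subspace_add[OF V, of x y] by (simp add: K_def)
      show "c *\<^sub>R x \<in> K" if "x \<in> K" for c x
        using that v_scale[of x c] subspace_scale[OF V, of x c] by (simp add: K_def)
    qed
    have KV: "K \<subseteq> V" by (auto simp: K_def)
    moreover have "K \<noteq> V" using v_pos by (force simp: K_def)
    ultimately have "span K \<subset> span V" using K V by (simp add: span_eq_iff[THEN iffD2] psubset_eq)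
    then have "dim K < dim V" by (rule dim_psubset)
    moreover have K_inv: "A *v x \<in> K" if "A \<in> M" "x \<in> K" for A x
      using that v_inv[of A x] inv[of A x] v(1)[of "A *v x"] by (simp add: K_def)
    ultimately obtain g c C where g: "0 < c" "\<And>x. x \<in> K \<Longrightarrow> c * norm x \<le> g x"
        "\<And>x. x \<in> K \<Longrightarrow> g x \<le> C * norm x"
      and g_add: "\<And>x y. x \<in> K \<Longrightarrow> y \<in> K \<Longrightarrow> g (x + y) \<le> g x + g y"
      and g_inv: "\<And>A x. A \<in> M \<Longrightarrow> x \<in> K \<Longrightarrow> g (A *v x) \<le> s * g x"
      using less.hyps[OF _ K] by blast
    obtain P where P: "range P \<subseteq> K" "linear P" "\<And>x. x \<in> K \<Longrightarrow> P x = x"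
      using linear_exists_left_inverse_on[OF linear_ident K] by auto
    have PK: "P x \<in> K" for x using P(1) by auto
    have PP: "P (P x) = P x" for x using P(3)[OF PK] .
    obtain G where G: "0 < G" "\<And>x. norm (P x) \<le> G * norm x"
      using linear_bounded_pos[OF P(2)] by blast
    have QV: "x - P x \<in> V" if "x \<in> V" for x
      using that KV PK subspace_diff[OF V] by blast
    have v_Q: "v (x - P x) \<le> v x" if "x \<in> V" for x
    proof -
      have "P x \<in> V" "v (P x) = 0" using PK[of x] by (auto simp: K_def)
      then have "v (- P x) = 0" "- P x \<in> V"
        using v_scale[of "P x" "-1"] subspace_neg[OF V] by auto
      then show ?thesis using v_add[OF that, of "- P x"] by simp
    qed
    define Z where "Z = {x\<in>V. P x = 0}"
    have Z: "Real_Vector_Spaces.subspace Z"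
      using subspace_0[OF V] subspace_add[OF V] subspace_scale[OF V] P(2) unfolding Z_def
      by (intro subspaceI) (auto simp: linear_0 linear_add linear_scale)
    have "continuous_on Z v"
    proof (rule lipschitz_continuous_on)
      fix x y assume "x \<in> Z" "y \<in> Z"
      then have xy: "x \<in> V" "y \<in> V" "x - y \<in> V" "y - x \<in> V"
        using subspace_diff[OF V] by (auto simp: Z_def)
      show "\<bar>v x - v y\<bar> \<le> 1 * norm (x - y)"
        using v_add[OF xy(3,2)] v_add[OF xy(4,1)] v(2)[OF xy(3)] v(2)[OF xy(4)]
        by (simp add: norm_minus_commute abs_le_iff)
    qed
    moreover have "0 < v x" if "x \<in> Z" "x \<noteq> 0" for x
      using that v(1)[of x] P(3)[of x] by (force simp: Z_def K_def)
    ultimately obtain m where m: "0 < m" "\<And>x. x \<in> Z \<Longrightarrow> m * norm x \<le> v x"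
      using positive_homogeneous_lower_bound[OF Z, of v] v_scale by (auto simp: Z_def)
    have Q_le: "m * norm (x - P x) \<le> v x" if "x \<in> V" for x
    proof -
      have "x - P x \<in> Z" using QV[OF that] linear_diff[OF P(2)] PP by (simp add: Z_def)
      from m(2)[OF this] v_Q[OF that] show ?thesis by linarith
    qed
    \<comment> \<open>\<open>E\<close> bounds the off-diagonal block from \<open>v\<close> to \<open>g\<close>; \<open>D\<close> is chosen so that \<open>E \<le> D * (s - r)\<close>.\<close>
    define E where "E = \<bar>C\<bar> * G * \<bar>B\<bar> / m"
    define D where "D = E / (s - r) + 1"
    have E: "0 \<le> E" using G(1) m(1) by (simp add: E_def)
    have D: "1 \<le> D" using E r by (simp add: D_def)
    define h where "h x = g (P x) + D * v x" for x
    have h_inv: "h (A *v x) \<le> s * h x" if A: "A \<in> M" and x: "x \<in> V" for A x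
    proof -
      have "A *v x = A *v P x + A *v (x - P x)"
        by (simp add: matrix_vector_mult_diff_distrib)
      then have "P (A *v x) = A *v P x + P (A *v (x - P x))"
        using linear_add[OF P(2)] P(3)[OF K_inv[OF A PK]] by metis
      then have 1: "g (P (A *v x)) \<le> g (A *v P x) + g (P (A *v (x - P x)))"
        using g_add[OF K_inv[OF A PK] PK] by metis
      have "norm (P (A *v (x - P x))) \<le> G * norm (A *v (x - P x))" by (rule G(2))
      also have "\<dots> \<le> G * (norm A * norm (x - P x))"
        using G(1) norm_matrix_vector_le by (intro mult_left_mono) auto
      also have "\<dots> \<le> G * (\<bar>B\<bar> * norm (x - P x))"
        using G(1) bdd[OF A] by (intro mult_left_mono mult_right_mono) auto
      also have "\<dots> \<le> G * (\<bar>B\<bar> * (v x / m))"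
        using G(1) Q_le[OF x] m(1) by (intro mult_left_mono) (auto simp: field_simps)
      finally have "\<bar>C\<bar> * norm (P (A *v (x - P x))) \<le> \<bar>C\<bar> * (G * (\<bar>B\<bar> * (v x / m)))"
        by (rule mult_left_mono) simp
      moreover have "C * norm (P (A *v (x - P x))) \<le> \<bar>C\<bar> * norm (P (A *v (x - P x)))"
        by (rule mult_right_mono) auto
      ultimately have 2: "g (P (A *v (x - P x))) \<le> E * v x"
        using g(3)[OF PK, of "A *v (x - P x)"] by (simp add: E_def)
      have "D * (s - r) = E + (s - r)" using r(2) by (simp add: D_def distrib_right)
      then have "E \<le> D * (s - r)" using r(2) by simp
      then have "E * v x \<le> D * (s - r) * v x" using v(1)[OF x] by (rule mult_right_mono)
      moreover have "D * v (A *v x) \<le> D * (r * v x)"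
        using v_inv[OF A x] D by (intro mult_left_mono) auto
      ultimately show ?thesis
        using 1 2 g_inv[OF A PK[of x]] unfolding h_def by (simp add: algebra_simps)
    qed
    have h_lower: "min c m * norm x \<le> h x" if x: "x \<in> V" for x
    proof -
      have "min c m * norm x \<le> min c m * (norm (P x) + norm (x - P x))"
        using g(1) m(1) norm_triangle_ineq[of "P x" "x - P x"] by (intro mult_left_mono) auto
      also have "\<dots> \<le> c * norm (P x) + m * norm (x - P x)"
        by (simp add: distrib_left add_mono mult_right_mono)
      also have "\<dots> \<le> g (P x) + 1 * v x" using g(2)[OF PK] Q_le[OF x] by (simp add: add_mono)
      also have "\<dots> \<le> h x" using D v(1)[OF x] unfolding h_def by (intro add_left_mono mult_right_mono)
      finally show ?thesis .
    qed
    have h_upper: "h x \<le> (\<bar>C\<bar> * G + D) * norm x" if x: "x \<in> V" for x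
    proof -
      have "g (P x) \<le> \<bar>C\<bar> * norm (P x)"
        using g(3)[OF PK] by (rule order_trans) (intro mult_right_mono, auto)
      also have "\<dots> \<le> \<bar>C\<bar> * (G * norm x)" using G(2) by (intro mult_left_mono) auto
      finally have "g (P x) \<le> \<bar>C\<bar> * (G * norm x)" .
      moreover have "D * v x \<le> D * norm x" using D v(2)[OF x] by (intro mult_left_mono) auto
      ultimately show ?thesis by (simp add: h_def algebra_simps)
    qed
    have h_add: "h (x + y) \<le> h x + h y" if "x \<in> V" "y \<in> V" for x y
    proof -
      have "D * v (x + y) \<le> D * (v x + v y)" using D v_add[OF that] by (intro mult_left_mono) auto
      moreover have "g (P (x + y)) \<le> g (P x) + g (P y)"
        using g_add[OF PK PK] linear_add[OF P(2)] by simp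
      ultimately show ?thesis by (simp add: h_def algebra_simps)
    qed
    have "0 < min c m" using g(1) m(1) by simp
    with h_lower h_upper h_add h_inv show ?thesis
      by (intro exI[of _ h] exI[of _ "min c m"] exI[of _ "\<bar>C\<bar> * G + D"]) blast
  qed
qed

lemma gauge_matrix_word:
  fixes M :: "(real^'n^'n) set" and g :: "real^'n \<Rightarrow> real"
  assumes "\<And>B x. B \<in> M \<Longrightarrow> g (B *v x) \<le> s * g x" "0 \<le> s" "\<And>i. i \<in> {1..k} \<Longrightarrow> A i \<in> M"
  shows "g (matrix_word A k *v x) \<le> s ^ k * g x"
  using assms(3)
proof (induction k)
  case 0 then show ?case by simp
next
  case (Suc k)
  have "g (matrix_word A (Suc k) *v x) = g (A (Suc k) *v (matrix_word A k *v x))"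
    by (simp add: matrix_vector_mul_assoc)
  also have "\<dots> \<le> s * g (matrix_word A k *v x)" using Suc.prems by (intro assms(1)) auto
  also have "\<dots> \<le> s * (s ^ k * g x)"
    using Suc.prems assms(2) by (intro mult_left_mono Suc.IH) auto
  finally show ?case by (simp add: mult.assoc)
qed

lemma norm_matrix_le_columns:
  fixes W :: "real^'n^'m"
  assumes "\<And>x. norm (W *v x) \<le> b * norm x"
  shows "norm W \<le> real (CARD('m) * CARD('n)) * b"
proof -
  have entry: "\<bar>W $ i $ j\<bar> \<le> b" for i j
  proof -
    have "\<bar>W $ i $ j\<bar> \<le> norm (W *v axis j 1)"
      using component_le_norm_cart[of "W *v axis j 1" i] by (simp add: matrix_vector_mul_component inner_axis)
    also have "\<dots> \<le> b" using assms[of "axis j 1"] by simp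
    finally show ?thesis .
  qed
  have "norm W \<le> (\<Sum>i\<in>UNIV. norm (W $ i))"
    unfolding norm_vec_def[of W] by (rule L2_set_le_sum) simp
  also have "\<dots> \<le> (\<Sum>i\<in>(UNIV::'m set). \<Sum>j\<in>(UNIV::'n set). b)"
    by (intro sum_mono order_trans[OF norm_le_l1_cart] entry)
  finally show ?thesis by (simp add: mult.assoc)
qed

section \<open>Tensor powers in coordinates\<close>

lemma sum_lessThan_mult_split:
  fixes g :: "nat \<Rightarrow> nat \<Rightarrow> 'a::comm_monoid_add"
  shows "(\<Sum>j<m * n. g (j div n) (j mod n)) = (\<Sum>a<m. \<Sum>b<n. g a b)"
proof -
  have bound: "a * n + b < m * n" if "a < m" "b < n" for a b
  proof -
    have "a * n + b < Suc a * n" using that by simp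
    also have "\<dots> \<le> m * n" using that by (intro mult_le_mono1) simp
    finally show ?thesis .
  qed
  have mod: "j mod n < n" if "j < m * n" for j
    using that by (cases n) auto
  have "(\<Sum>j<m * n. g (j div n) (j mod n)) = (\<Sum>(a, b)\<in>{..<m} \<times> {..<n}. g a b)"
    by (rule sum.reindex_bij_witness[where i="\<lambda>(a, b). a * n + b" and j="\<lambda>j. (j div n, j mod n)"])
      (auto simp: less_mult_imp_div_less bound mod)
  then show ?thesis by (simp add: sum.cartesian_product)
qed

text \<open>The coordinates of the elementary tensor with factors \<open>x (p - 1)\<close>, ..., \<open>x 0\<close>: in base \<open>CARD('n)\<close> the leading
digit of the coordinate number belongs to the factor \<open>x (p - 1)\<close>. This is the order in which
\<^const>\<open>kronecker_power\<close> nests its factors. Distinct factors are needed because values at diagonal tensors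
do not determine a multilinear form.\<close>

fun tensor :: "nat \<Rightarrow> (nat \<Rightarrow> real^'n) \<Rightarrow> nat \<Rightarrow> real" where
  "tensor 0 x i = 1"
| "tensor (Suc p) x i =
     x p $ from_nat_into UNIV (i div CARD('n) ^ p) * tensor p x (i mod CARD('n) ^ p)"

lemma sum_from_nat_into:
  "(\<Sum>a<CARD('n::finite). f (from_nat_into (UNIV :: 'n set) a)) = (\<Sum>b\<in>UNIV. f b)"
  by (rule sum.reindex_bij_betw) (simp add: bij_betw_from_nat_into_finite)

lemma kronecker_power_carrier:
  "kronecker_power (to_mat (X :: real^'n^'n)) p \<in> carrier_mat (CARD('n) ^ p) (CARD('n) ^ p)"
  by (induction p) (auto simp: kronecker_product_def to_mat_def)

lemma kronecker_power_Suc_entry: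
  fixes X :: "real^'n^'n"
  assumes "i < CARD('n) ^ Suc p" "j < CARD('n) ^ Suc p"
  shows "kronecker_power (to_mat X) (Suc p) $$ (i, j) =
    X $ from_nat_into UNIV (i div CARD('n) ^ p) $ from_nat_into UNIV (j div CARD('n) ^ p) *
    kronecker_power (to_mat X) p $$ (i mod CARD('n) ^ p, j mod CARD('n) ^ p)"
proof -
  have "dim_row (kronecker_power (to_mat X) p) = CARD('n) ^ p"
    "dim_col (kronecker_power (to_mat X) p) = CARD('n) ^ p"
    using kronecker_power_carrier[of X p] by auto
  moreover have "i div CARD('n) ^ p < CARD('n)" "j div CARD('n) ^ p < CARD('n)"
    using assms by (auto simp: less_mult_imp_div_less)
  ultimately show ?thesis
    using assms by (simp add: kronecker_product_def to_mat_def)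
qed

lemma kronecker_power_tensor:
  fixes X :: "real^'n^'n"
  assumes "i < CARD('n) ^ p"
  shows "(\<Sum>j<CARD('n) ^ p. kronecker_power (to_mat X) p $$ (i, j) * tensor p x j) =
    tensor p (\<lambda>l. X *v x l) i"
  using assms
proof (induction p arbitrary: i)
  case 0 then show ?case by simp
next
  case (Suc p)
  let ?d = "CARD('n)" and ?e = "from_nat_into (UNIV :: 'n set)"
  let ?i = "i div ?d ^ p" and ?i' = "i mod ?d ^ p"
  have i': "?i' < ?d ^ p" by simp
  have "(\<Sum>j<?d ^ Suc p. kronecker_power (to_mat X) (Suc p) $$ (i, j) * tensor (Suc p) x j) =
    (\<Sum>j<?d * ?d ^ p. (\<lambda>a b. (X $ ?e ?i $ ?e a * x p $ ?e a) *
      (kronecker_power (to_mat X) p $$ (?i', b) * tensor p x b)) (j div ?d ^ p) (j mod ?d ^ p))"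
    using Suc.prems
    by (intro sum.cong) (auto simp: kronecker_power_Suc_entry simp del: kronecker_power.simps)
  also have "\<dots> = (\<Sum>a<?d. X $ ?e ?i $ ?e a * x p $ ?e a) *
      (\<Sum>b<?d ^ p. kronecker_power (to_mat X) p $$ (?i', b) * tensor p x b)"
    by (subst sum_lessThan_mult_split) (simp add: sum_product)
  also have "(\<Sum>a<?d. X $ ?e ?i $ ?e a * x p $ ?e a) = (X *v x p) $ ?e ?i"
    by (simp add: sum_from_nat_into[of "\<lambda>b. X $ ?e ?i $ b * x p $ b"] matrix_vector_mult_def)
  finally show ?case using Suc.IH[OF i'] by simp
qed

lemma kronecker_power_entry_le:
  fixes X :: "real^'n^'n"
  assumes "i < CARD('n) ^ p" "j < CARD('n) ^ p"
  shows "\<bar>kronecker_power (to_mat X) p $$ (i, j)\<bar> \<le> norm X ^ p"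
  using assms
proof (induction p arbitrary: i j)
  case 0 then show ?case by simp
next
  case (Suc p)
  have "\<bar>X $ a $ b\<bar> \<le> norm X" for a b
    using component_le_norm_cart[of "X $ a" b] Finite_Cartesian_Product.norm_nth_le[of X a] by linarith
  then show ?case
    using Suc.IH[of "i mod CARD('n) ^ p" "j mod CARD('n) ^ p"] Suc.prems
    by (simp add: kronecker_power_Suc_entry abs_mult mult_mono del: kronecker_power.simps)
qed

lemma kronecker_power_entry_measurable:
  fixes A :: "'w \<Rightarrow> real^'n^'n"
  assumes "A \<in> borel_measurable P" "i < CARD('n) ^ p" "j < CARD('n) ^ p"
  shows "(\<lambda>\<omega>. kronecker_power (to_mat (A \<omega>)) p $$ (i, j)) \<in> borel_measurable P"
  using assms(2,3)
proof (induction p arbitrary: i j)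
  case 0 then show ?case by simp
next
  case (Suc p)
  have "(\<lambda>X. X $ a $ b) \<in> borel_measurable (borel :: (real^'n^'n) measure)" for a b
    by (intro borel_measurable_continuous_onI continuous_intros)
  then have "(\<lambda>\<omega>. A \<omega> $ a $ b) \<in> borel_measurable P" for a b
    using measurable_compose[OF assms(1)] by blast
  then show ?case
    using Suc.IH[of "i mod CARD('n) ^ p" "j mod CARD('n) ^ p"] Suc.prems
    by (simp add: kronecker_power_Suc_entry del: kronecker_power.simps)
qed

lemma tensor_cong:
  "(\<And>l. l < p \<Longrightarrow> x l = y l) \<Longrightarrow> tensor p x i = tensor p y i"
  by (induction p arbitrary: i) auto

lemma tensor_le:
  assumes "\<And>l. l < p \<Longrightarrow> norm (x l) \<le> b l"
  shows "\<bar>tensor p x i\<bar> \<le> (\<Prod>l<p. b l)"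
  using assms
proof (induction p arbitrary: i)
  case 0 then show ?case by simp
next
  case (Suc p)
  have "\<bar>x p $ a\<bar> \<le> b p" for a
    using component_le_norm_cart[of "x p" a] Suc.prems[of p] by simp
  moreover have "\<bar>tensor p x j\<bar> \<le> (\<Prod>l<p. b l)" for j using Suc by simp
  moreover have "0 \<le> b p" using norm_ge_zero[of "x p"] Suc.prems[of p] by linarith
  ultimately show ?case
    by (simp add: abs_mult mult.commute[of "prod b {..<p}"] mult_mono)
qed

lemma tensor_diagonal_le:
  assumes "\<And>a. \<bar>x $ a\<bar> \<le> m"
  shows "\<bar>tensor p (\<lambda>_. x) i\<bar> \<le> m ^ p"
proof (induction p arbitrary: i)
  case 0 then show ?case by simp
next
  case (Suc p)
  have "0 \<le> m" using assms[of undefined] by linarith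
  then show ?case using Suc assms by (simp add: abs_mult mult_mono)
qed

lemma tensor_scale:
  "tensor p (\<lambda>_. c *\<^sub>R x) i = c ^ p * tensor p (\<lambda>_. x) i"
  by (induction p arbitrary: i) (auto simp: mult_ac)

lemma tensor_basis:
  assumes "J < CARD('n::finite) ^ p"
  shows "\<exists>x :: nat \<Rightarrow> real^'n. \<forall>i<CARD('n) ^ p. tensor p x i = (if i = J then 1 else 0)"
  using assms
proof (induction p arbitrary: J)
  case 0 then show ?case by simp
next
  case (Suc p)
  let ?d = "CARD('n)" and ?e = "from_nat_into (UNIV :: 'n set)"
  obtain x :: "nat \<Rightarrow> real^'n"
    where x: "\<forall>i<?d ^ p. tensor p x i = (if i = J mod ?d ^ p then 1 else 0)"
    using Suc.IH[of "J mod ?d ^ p"] by auto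
  define y where "y = x(p := axis (?e (J div ?d ^ p)) 1)"
  have "tensor (Suc p) y i = (if i = J then 1 else 0)" if i: "i < ?d ^ Suc p" for i
  proof -
    have "i div ?d ^ p < ?d" "J div ?d ^ p < ?d"
      using i Suc.prems by (auto simp: less_mult_imp_div_less)
    then have "?e (i div ?d ^ p) = ?e (J div ?d ^ p) \<longleftrightarrow> i div ?d ^ p = J div ?d ^ p"
      using bij_betw_from_nat_into_finite[of "UNIV :: 'n set"]
      by (auto simp: bij_betw_def inj_on_def)
    moreover have "tensor p y (i mod ?d ^ p) = tensor p x (i mod ?d ^ p)"
      by (rule tensor_cong) (simp add: y_def)
    moreover have "i = J \<longleftrightarrow> i div ?d ^ p = J div ?d ^ p \<and> i mod ?d ^ p = J mod ?d ^ p"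
      by (metis div_mult_mod_eq)
    ultimately show ?thesis using x by (auto simp: y_def axis_def)
  qed
  then show ?case by blast
qed

text \<open>The coordinate whose digits all stand for \<open>a\<close>. It makes \<open>x $ a ^ p\<close> a linear function of the tensor power.\<close>

lemma tensor_diagonal_power:
  "\<exists>J<CARD('n::finite) ^ p. \<forall>x :: real^'n. tensor p (\<lambda>_. x) J = x $ a ^ p"
proof (induction p)
  case 0 then show ?case by simp
next
  case (Suc p)
  let ?d = "CARD('n)" and ?e = "from_nat_into (UNIV :: 'n set)"
  obtain J where J: "J < ?d ^ p" "\<forall>x :: real^'n. tensor p (\<lambda>_. x) J = x $ a ^ p"
    using Suc by blast
  obtain k where k: "k < ?d" "?e k = a"
    using bij_betw_from_nat_into_finite[of "UNIV :: 'n set"]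
    unfolding bij_betw_def by (metis UNIV_I finite_code imageE lessThan_iff)
  have "k * ?d ^ p + J < Suc k * ?d ^ p" using J(1) by simp
  also have "\<dots> \<le> ?d * ?d ^ p" using k(1) by (intro mult_le_mono1) simp
  finally have "k * ?d ^ p + J < ?d ^ Suc p" by simp
  moreover have "\<forall>x :: real^'n. tensor (Suc p) (\<lambda>_. x) (k * ?d ^ p + J) = x $ a ^ Suc p"
    using J k by simp
  ultimately show ?case by blast
qed

definition tensor_form :: "nat \<Rightarrow> (nat \<Rightarrow> 'b::real_vector) \<Rightarrow> (nat \<Rightarrow> real^'n) \<Rightarrow> 'b" where
  "tensor_form p u x = (\<Sum>i<CARD('n) ^ p. tensor p x i *\<^sub>R u i)"

lemma tensor_form_le:
  fixes u :: "nat \<Rightarrow> 'b::real_normed_vector" and x :: "nat \<Rightarrow> real^'n"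
  assumes "\<And>l. l < p \<Longrightarrow> norm (x l) \<le> b l"
  shows "norm (tensor_form p u x) \<le> (\<Sum>i<CARD('n) ^ p. norm (u i)) * (\<Prod>l<p. b l)"
  unfolding tensor_form_def sum_distrib_right
  by (rule order_trans[OF norm_sum sum_mono])
    (simp add: mult.commute mult_left_mono tensor_le[OF assms])

section \<open>Averaging over a random matrix\<close>

text \<open>The set \<open>M\<close> stands for the support of the law of \<open>A\<close>: almost surely \<open>A\<close> lies in \<open>M\<close>, and it comes close to every
element of \<open>M\<close> with positive probability.\<close>

locale bounded_random_matrix = prob_space P
  for P :: "'w measure" +
  fixes A :: "'w \<Rightarrow> real^'n^'n" and M :: "(real^'n^'n) set" and B :: real
  assumes A_measurable: "A \<in> borel_measurable P"
    and M_bounded: "\<And>X. X \<in> M \<Longrightarrow> norm X \<le> B"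
    and A_in_M: "AE \<omega> in P. A \<omega> \<in> M"
    and A_near: "\<And>X e. X \<in> M \<Longrightarrow> 0 < e \<Longrightarrow> 0 < prob {\<omega> \<in> space P. norm (X - A \<omega>) < e}"
begin

abbreviation "mean_power \<equiv> expected_kronecker_power P A"

lemma mean_power_carrier [simp]: "mean_power p \<in> carrier_mat (CARD('n) ^ p) (CARD('n) ^ p)"
  by (simp add: expected_kronecker_power_def)

lemma mean_power_dim [simp]: "dim_row (mean_power p) = CARD('n) ^ p" "dim_col (mean_power p) = CARD('n) ^ p"
  using mean_power_carrier[of p] by (auto simp del: mean_power_carrier)

lemma M_nonempty: "M \<noteq> {}"
proof
  assume "M = {}"
  then have "AE \<omega> in P. False" using A_in_M by simp
  then show False by simp
qed

lemma integrable_kronecker_power_entry: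
  assumes "i < CARD('n) ^ p" "j < CARD('n) ^ p"
  shows "integrable P (\<lambda>\<omega>. kronecker_power (to_mat (A \<omega>)) p $$ (i, j))"
proof (rule integrable_const_bound[where B="B ^ p"])
  show "AE \<omega> in P. norm (kronecker_power (to_mat (A \<omega>)) p $$ (i, j)) \<le> B ^ p"
    using A_in_M
  proof eventually_elim
    case (elim \<omega>)
    show ?case
      using kronecker_power_entry_le[OF assms, of "A \<omega>"] power_mono[OF M_bounded[OF elim], of p]
      by simp
  qed
qed (rule kronecker_power_entry_measurable[OF A_measurable assms])

lemma tensor_expectation:
  assumes "i < CARD('n) ^ p"
  shows "integrable P (\<lambda>\<omega>. tensor p (\<lambda>l. A \<omega> *v x l) i)"
    and "(\<integral>\<omega>. tensor p (\<lambda>l. A \<omega> *v x l) i \<partial>P) = (\<Sum>j<CARD('n) ^ p. mean_power p $$ (i, j) * tensor p x j)"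
proof -
  have int: "integrable P (\<lambda>\<omega>. kronecker_power (to_mat (A \<omega>)) p $$ (i, j) * tensor p x j)"
    if "j \<in> {..<CARD('n) ^ p}" for j
    using integrable_kronecker_power_entry[OF assms, of j] that by simp
  show "integrable P (\<lambda>\<omega>. tensor p (\<lambda>l. A \<omega> *v x l) i)"
    unfolding kronecker_power_tensor[OF assms, symmetric]
    by (rule Bochner_Integration.integrable_sum[OF int])
  show "(\<integral>\<omega>. tensor p (\<lambda>l. A \<omega> *v x l) i \<partial>P) = (\<Sum>j<CARD('n) ^ p. mean_power p $$ (i, j) * tensor p x j)"
    unfolding kronecker_power_tensor[OF assms, symmetric]
    by (subst Bochner_Integration.integral_sum, erule int)
      (use assms in \<open>auto simp: expected_kronecker_power_def intro!: sum.cong\<close>)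
qed

text \<open>The transpose of the mean Kronecker power. On the coefficients of multilinear forms it describes the map that
sends a form to its average over a substitution of \<open>A\<close> in all arguments.\<close>

definition mean_pullback :: "nat \<Rightarrow> (nat \<Rightarrow> 'b::real_vector) \<Rightarrow> nat \<Rightarrow> 'b" where
  "mean_pullback p u j = (\<Sum>i<CARD('n) ^ p. mean_power p $$ (i, j) *\<^sub>R u i)"

lemma tensor_form_expectation:
  fixes u :: "nat \<Rightarrow> 'b::{banach, second_countable_topology}"
  shows "integrable P (\<lambda>\<omega>. tensor_form p u (\<lambda>l. A \<omega> *v x l))"
    and "(\<integral>\<omega>. tensor_form p u (\<lambda>l. A \<omega> *v x l) \<partial>P) = tensor_form p (mean_pullback p u) x"
proof -
  have int: "integrable P (\<lambda>\<omega>. tensor p (\<lambda>l. A \<omega> *v x l) i *\<^sub>R u i)"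
    if "i \<in> {..<CARD('n) ^ p}" for i
    using tensor_expectation(1)[of i p x] that by simp
  show "integrable P (\<lambda>\<omega>. tensor_form p u (\<lambda>l. A \<omega> *v x l))"
    unfolding tensor_form_def by (rule Bochner_Integration.integrable_sum[OF int])
  have "(\<integral>\<omega>. tensor_form p u (\<lambda>l. A \<omega> *v x l) \<partial>P) =
    (\<Sum>i<CARD('n) ^ p. (\<Sum>j<CARD('n) ^ p. mean_power p $$ (i, j) * tensor p x j) *\<^sub>R u i)"
    unfolding tensor_form_def
    by (subst Bochner_Integration.integral_sum, erule int)
      (auto simp: tensor_expectation intro!: sum.cong)
  also have "\<dots> = (\<Sum>i<CARD('n) ^ p. \<Sum>j<CARD('n) ^ p. tensor p x j *\<^sub>R mean_power p $$ (i, j) *\<^sub>R u i)"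
    by (simp add: scaleR_sum_left mult.commute)
  also have "\<dots> = tensor_form p (mean_pullback p u) x"
    unfolding tensor_form_def mean_pullback_def scaleR_sum_right by (rule sum.swap)
  finally show "(\<integral>\<omega>. tensor_form p u (\<lambda>l. A \<omega> *v x l) \<partial>P) = tensor_form p (mean_pullback p u) x" .
qed

end

lemma matrix_word_shift:
  "matrix_word (\<lambda>i. if i = 1 then X else W (i - 1)) (Suc k) = matrix_word W k ** X"
  by (induction k) (auto simp: matrix_mul_assoc)

section \<open>Eigenvalues, matrix powers and convex forms\<close>

lemma power_le_of_eventually_le:
  fixes a b :: real
  assumes "0 < b" "\<And>k. k0 \<le> k \<Longrightarrow> a ^ k \<le> Q * b ^ k"
  shows "a \<le> b"
proof (rule ccontr)
  assume "\<not> a \<le> b"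
  then have "1 < a / b" using assms(1) by simp
  then obtain k where k: "Q < (a / b) ^ k" using real_arch_pow by blast
  also have "\<dots> \<le> (a / b) ^ (max k k0)" using \<open>1 < a / b\<close> by (intro power_increasing) auto
  also have "\<dots> \<le> Q" using assms(2)[of "max k k0"] assms(1) by (simp add: power_divide field_simps)
  finally show False by simp
qed

text \<open>A matrix and its transpose have the same characteristic polynomial.\<close>

lemma left_eigenvector:
  fixes C :: "'a::field mat"
  assumes C: "C \<in> carrier_mat n n" and ev: "eigenvalue C e"
  obtains u where "\<And>j. j < n \<Longrightarrow> (\<Sum>i<n. C $$ (i, j) * u i) = e * u j" "\<exists>i<n. u i \<noteq> 0"
proof -
  have Ct: "transpose_mat C \<in> carrier_mat n n" using C by simp
  have "eigenvalue (transpose_mat C) e"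
    using ev C by (simp add: eigenvalue_root_char_poly[OF C] eigenvalue_root_char_poly[OF Ct])
  then obtain v where v: "v \<in> carrier_vec n" "v \<noteq> 0\<^sub>v n" "transpose_mat C *\<^sub>v v = e \<cdot>\<^sub>v v"
    using C unfolding eigenvalue_def eigenvector_def by auto
  show ?thesis
  proof (rule that)
    fix j assume j: "j < n"
    have "(\<Sum>i<n. C $$ (i, j) * vec_index v i) = vec_index (transpose_mat C *\<^sub>v v) j"
      using j C v(1) by (simp add: scalar_prod_def lessThan_atLeast0)
    then show "(\<Sum>i<n. C $$ (i, j) * vec_index v i) = e * vec_index v j"
      using j v by simp
  next
    show "\<exists>i<n. vec_index v i \<noteq> 0"
    proof (rule ccontr)
      assume "\<not> (\<exists>i<n. vec_index v i \<noteq> 0)"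
      then have "v = 0\<^sub>v n" using v(1) by (intro eq_vecI) auto
      with v(2) show False by simp
    qed
  qed
qed

lemma smult_pow_mat:
  fixes C :: "'a::comm_semiring_1 mat"
  assumes C: "C \<in> carrier_mat n n"
  shows "(c \<cdot>\<^sub>m C) ^\<^sub>m k = c ^ k \<cdot>\<^sub>m C ^\<^sub>m k"
proof (induction k)
  case 0
  show ?case using C by (intro eq_matI) auto
next
  case (Suc k)
  have "(c \<cdot>\<^sub>m C) ^\<^sub>m Suc k = c ^ k \<cdot>\<^sub>m C ^\<^sub>m k * (c \<cdot>\<^sub>m C)" using Suc by simp
  also have "\<dots> = c ^ Suc k \<cdot>\<^sub>m (C ^\<^sub>m k * C)"
    using C by (intro eq_matI) (auto simp: mult_ac)
  finally show ?case by simp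
qed

text \<open>Dividing by \<open>t\<close> brings the spectral radius below 1, and then the Jordan normal form bounds all powers.\<close>

lemma spectral_radius_power_bound:
  fixes D :: "real mat"
  assumes D: "D \<in> carrier_mat n n" and n: "0 < n" and t: "0 < t"
    and sr: "spectral_radius (map_mat complex_of_real D) < t"
  shows "\<exists>c. \<forall>k. \<forall>i<n. \<forall>j<n. \<bar>(D ^\<^sub>m k) $$ (i, j)\<bar> \<le> c * t ^ k"
proof -
  let ?C = "map_mat complex_of_real D"
  let ?E = "inverse t \<cdot>\<^sub>m D"
  let ?F = "map_mat complex_of_real ?E"
  have C: "?C \<in> carrier_mat n n" and E: "?E \<in> carrier_mat n n" and F: "?F \<in> carrier_mat n n"
    using D by auto
  have FC: "?F = complex_of_real (inverse t) \<cdot>\<^sub>m ?C" using D by (intro eq_matI) auto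
  obtain e where e: "eigenvalue ?F e" "spectral_radius ?F = cmod e"
    using spectral_radius_mem_max(1)[OF F n] by (auto simp: spectrum_def)
  then obtain v where v: "v \<in> carrier_vec n" "v \<noteq> 0\<^sub>v n" "?F *\<^sub>v v = e \<cdot>\<^sub>v v"
    using F unfolding eigenvalue_def eigenvector_def by auto
  have "?C *\<^sub>v v = (t * e) \<cdot>\<^sub>v v"
  proof (rule eq_vecI)
    fix i assume i: "i < dim_vec ((t * e) \<cdot>\<^sub>v v)"
    then have "vec_index (?F *\<^sub>v v) i = e * vec_index v i" using v by simp
    moreover have "vec_index (?F *\<^sub>v v) i = inverse t * vec_index (?C *\<^sub>v v) i"
      using i v(1) D by (simp add: scalar_prod_def sum_distrib_left mult_ac)
    ultimately show "vec_index (?C *\<^sub>v v) i = vec_index ((t * e) \<cdot>\<^sub>v v) i"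
      using i v(1) t by (simp add: field_simps)
  qed (use C v in auto)
  then have "eigenvalue ?C (t * e)"
    using v C D unfolding eigenvalue_def eigenvector_def by auto
  then have "cmod (t * e) \<le> spectral_radius ?C"
    by (intro spectral_radius_mem_max(2)[OF C n]) (auto simp: spectrum_def)
  then have "t * cmod e \<le> spectral_radius ?C" using t by (simp add: norm_mult)
  then have "t * cmod e < t * 1" using sr by linarith
  then have "cmod e < 1" by (rule mult_left_less_imp_less) (use t in simp)
  then have "spectral_radius ?F < 1" using e(2) by simp
  then obtain c where c: "\<And>k. norm_bound (?F ^\<^sub>m k) c"
    using spectral_radius_jnf_norm_bound_less_1_upper_triangular[OF F] by blast
  have "\<bar>(D ^\<^sub>m k) $$ (i, j)\<bar> \<le> c * t ^ k" if ij: "i < n" "j < n" for k i j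
  proof -
    have Dk: "D ^\<^sub>m k \<in> carrier_mat n n" using D by simp
    have "?F ^\<^sub>m k = map_mat complex_of_real (?E ^\<^sub>m k)"
      by (rule of_real_hom.mat_hom_pow[OF E, symmetric])
    also have "\<dots> = map_mat complex_of_real (inverse t ^ k \<cdot>\<^sub>m D ^\<^sub>m k)"
      by (simp add: smult_pow_mat[OF D])
    finally have Fk: "?F ^\<^sub>m k = map_mat complex_of_real (inverse t ^ k \<cdot>\<^sub>m D ^\<^sub>m k)" .
    have "norm ((?F ^\<^sub>m k) $$ (i, j)) \<le> c"
      using c[of k] ij pow_carrier_mat[OF F, of k] unfolding norm_bound_def
      by (simp only: carrier_matD)
    moreover have "norm ((?F ^\<^sub>m k) $$ (i, j)) = \<bar>(D ^\<^sub>m k) $$ (i, j)\<bar> / t ^ k"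
    proof -
      have "(?F ^\<^sub>m k) $$ (i, j) = complex_of_real ((inverse t ^ k \<cdot>\<^sub>m D ^\<^sub>m k) $$ (i, j))"
        unfolding Fk using ij carrier_matD[OF Dk] by (intro index_map_mat) simp_all
      moreover have "(inverse t ^ k \<cdot>\<^sub>m D ^\<^sub>m k) $$ (i, j) = inverse t ^ k * (D ^\<^sub>m k) $$ (i, j)"
        using ij carrier_matD[OF Dk] by (intro index_smult_mat) simp_all
      ultimately have "norm ((?F ^\<^sub>m k) $$ (i, j)) = \<bar>inverse t ^ k * (D ^\<^sub>m k) $$ (i, j)\<bar>"
        by (simp only: norm_of_real)
      then show ?thesis using t by (simp add: abs_mult power_inverse divide_inverse mult.commute)
    qed
    ultimately have "\<bar>(D ^\<^sub>m k) $$ (i, j)\<bar> / t ^ k \<le> c" by (simp only:)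
    then show ?thesis using t by (simp add: pos_divide_le_eq)
  qed
  then show ?thesis by blast
qed

text \<open>The sublevel set \<open>{x. f x \<le> 1}\<close> is convex and balanced, and \<open>root p (f x)\<close> is its Minkowski functional. This
replaces the Minkowski inequality for means of order \<open>p\<close>: convexity passes through sums and expectations
without effort.\<close>

lemma convex_homogeneous_root_seminorm:
  fixes f :: "'a::real_vector \<Rightarrow> real"
  assumes p: "0 < p" and cvx: "convex_on UNIV f"
    and hom: "\<And>c x. f (c *\<^sub>R x) = \<bar>c\<bar> ^ p * f x"
    and pos: "\<And>x. x \<noteq> 0 \<Longrightarrow> 0 < f x"
  shows "seminorm (\<lambda>x. root p (f x))"
proof -
  define N where "N x = root p (f x)" for x
  have f0: "f 0 = 0" using hom[of 0 0] p by (simp add: zero_power)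
  have f_nonneg: "0 \<le> f x" for x using pos[of x] f0 by (cases "x = 0") auto
  have N_pow: "N x ^ p = f x" for x using p f_nonneg by (simp add: N_def)
  have N_scale: "N (c *\<^sub>R x) = \<bar>c\<bar> * N x" for c x
    using p by (simp add: N_def hom real_root_mult real_root_power_cancel)
  have N_pos: "0 < N x" if "x \<noteq> 0" for x using p pos[OF that] by (simp add: N_def)
  have N0: "N 0 = 0" using f0 by (simp add: N_def)
  have N_add: "N (x + y) \<le> N x + N y" for x y
  proof (cases "x = 0 \<or> y = 0")
    case True then show ?thesis using N0 by auto
  next
    case False
    define a b where "a = N x" and "b = N y"
    have ab: "0 < a" "0 < b" using False N_pos by (auto simp: a_def b_def)
    have unit: "f (x /\<^sub>R a) = 1" "f (y /\<^sub>R b) = 1"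
      using ab N_pow[of x] N_pow[of y] by (auto simp: hom a_def b_def power_inverse field_simps)
    \<comment> \<open>A convex combination of two unit vectors with weights \<open>a / (a + b)\<close> and \<open>b / (a + b)\<close>.\<close>
    have "(x + y) /\<^sub>R (a + b) = (1 - b / (a + b)) *\<^sub>R (x /\<^sub>R a) + (b / (a + b)) *\<^sub>R (y /\<^sub>R b)"
      using ab by (simp add: field_simps scaleR_add_right)
    also have "f \<dots> \<le> (1 - b / (a + b)) * f (x /\<^sub>R a) + (b / (a + b)) * f (y /\<^sub>R b)"
      using ab by (intro convex_onD[OF cvx]) auto
    also have "\<dots> = 1" by (simp add: unit)
    finally have "inverse (a + b) ^ p * f (x + y) \<le> 1" using ab by (simp add: hom)
    then have "f (x + y) \<le> (a + b) ^ p" using ab by (simp add: field_simps)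
    then have "root p (f (x + y)) \<le> root p ((a + b) ^ p)" using p by simp
    then show ?thesis using p ab by (simp add: N_def[symmetric] real_root_power_cancel a_def b_def)
  qed
  show ?thesis using N_add N_scale unfolding seminorm_def N_def by blast
qed

context bounded_random_matrix
begin

text \<open>One average at a time: the eigenvalue equation trades a factor \<open>e\<close> for the argument \<open>A \<omega> *v x l\<close>, and the
induction hypothesis holds there for almost every \<open>\<omega>\<close>. Independent copies of \<open>A\<close> are thereby avoided.\<close>

lemma eigenvalue_word_bound:
  fixes u :: "nat \<Rightarrow> complex"
  assumes ev: "\<And>j. j < CARD('n) ^ p \<Longrightarrow> mean_pullback p u j = e * u j"
    and "\<And>W. (\<And>i. i \<in> {1..k} \<Longrightarrow> W i \<in> M) \<Longrightarrow>
      cmod (tensor_form p u (\<lambda>l. matrix_word W k *v x l)) \<le> K"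
  shows "cmod e ^ k * cmod (tensor_form p u x) \<le> K"
  using assms(2)
proof (induction k arbitrary: x)
  case 0 then show ?case by simp
next
  case (Suc k)
  have "tensor_form p (mean_pullback p u) x = e * tensor_form p u x"
    by (simp add: tensor_form_def ev sum_distrib_left mult.left_commute scaleR_conv_of_real)
  then have "cmod e * cmod (tensor_form p u x) = cmod (\<integral>\<omega>. tensor_form p u (\<lambda>l. A \<omega> *v x l) \<partial>P)"
    by (simp add: tensor_form_expectation norm_mult)
  also have "\<dots> \<le> (\<integral>\<omega>. cmod (tensor_form p u (\<lambda>l. A \<omega> *v x l)) \<partial>P)"
    by (rule integral_norm_bound)
  finally have "cmod e ^ k * (cmod e * cmod (tensor_form p u x)) \<le>
      cmod e ^ k * (\<integral>\<omega>. cmod (tensor_form p u (\<lambda>l. A \<omega> *v x l)) \<partial>P)"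
    by (rule mult_left_mono) simp
  also have "\<dots> = (\<integral>\<omega>. cmod e ^ k * cmod (tensor_form p u (\<lambda>l. A \<omega> *v x l)) \<partial>P)"
    by simp
  also have "\<dots> \<le> K"
  proof (rule integral_le_const)
    show "integrable P (\<lambda>\<omega>. cmod e ^ k * cmod (tensor_form p u (\<lambda>l. A \<omega> *v x l)))"
      by (intro integrable_mult_right integrable_norm tensor_form_expectation)
    show "AE \<omega> in P. cmod e ^ k * cmod (tensor_form p u (\<lambda>l. A \<omega> *v x l)) \<le> K"
      using A_in_M
    proof eventually_elim
      case (elim \<omega>)
      show ?case
      proof (rule Suc.IH)
        fix W assume W: "\<And>i. i \<in> {1..k} \<Longrightarrow> W i \<in> M"
        let ?W = "\<lambda>i. if i = 1 then A \<omega> else W (i - 1)"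
        have "?W i \<in> M" if "i \<in> {1..Suc k}" for i 
        proof (cases "i = 1")
          case False
          then have "i - 1 \<in> {1..k}" using that by auto
          then show ?thesis using W False by simp
        qed (use elim in simp)
        from Suc.prems[of ?W, OF this]
        show "cmod (tensor_form p u (\<lambda>l. matrix_word W k *v (A \<omega> *v x l))) \<le> K"
          unfolding matrix_word_shift by (simp add: matrix_vector_mul_assoc)
      qed
    qed
  qed
  finally show ?case by (simp add: mult.assoc mult.left_commute)
qed

text \<open>The form with coefficients \<open>u\<close> is nonzero at some tuple \<open>x\<close>, and at the images of \<open>x\<close> under words of length \<open>k\<close>
it grows at most like \<open>(s ^ p) ^ k\<close>.\<close>

lemma eigenvalue_le:
  assumes ev: "eigenvalue (map_mat complex_of_real (mean_power p)) e" and s: "0 < s"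
    and words: "\<And>k W. k0 \<le> k \<Longrightarrow> (\<And>i. i \<in> {1..k} \<Longrightarrow> W i \<in> M) \<Longrightarrow> norm (matrix_word W k) \<le> s ^ k"
  shows "cmod e \<le> s ^ p"
proof -
  have "map_mat complex_of_real (mean_power p) \<in> carrier_mat (CARD('n) ^ p) (CARD('n) ^ p)" by simp
  from left_eigenvector[OF this ev] obtain u where
    u: "\<And>j. j < CARD('n) ^ p \<Longrightarrow>
      (\<Sum>i<CARD('n) ^ p. map_mat complex_of_real (mean_power p) $$ (i, j) * u i) = e * u j"
    and "\<exists>J<CARD('n) ^ p. u J \<noteq> 0" by blast
  then obtain J where J: "J < CARD('n) ^ p" "u J \<noteq> 0" by blast
  have mean_pullback: "mean_pullback p u j = e * u j" if "j < CARD('n) ^ p" for j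
    using u[OF that] that mean_power_carrier[of p] unfolding mean_pullback_def
    by (simp add: scaleR_conv_of_real)
  obtain x :: "nat \<Rightarrow> real^'n" where x: "\<forall>i<CARD('n) ^ p. tensor p x i = (if i = J then 1 else 0)"
    using tensor_basis[OF J(1)] by blast
  have "tensor_form p u x = (\<Sum>i<CARD('n) ^ p. if i = J then u i else 0)"
    unfolding tensor_form_def by (intro sum.cong) (auto simp: x)
  then have nz: "0 < cmod (tensor_form p u x)" using J by simp
  define Q where "Q = (\<Sum>i<CARD('n) ^ p. cmod (u i)) * (\<Prod>l<p. norm (x l))"
  show ?thesis
  proof (rule power_le_of_eventually_le)
    show "0 < s ^ p" using s by simp
    fix k assume k: "k0 \<le> k"
    have "cmod e ^ k * cmod (tensor_form p u x) \<le> Q * (s ^ p) ^ k"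
    proof (rule eigenvalue_word_bound[OF mean_pullback])
      fix W assume W: "\<And>i. i \<in> {1..k} \<Longrightarrow> W i \<in> M"
      have "norm (matrix_word W k *v x l) \<le> s ^ k * norm (x l)" for l
        by (rule order_trans[OF norm_matrix_vector_le mult_right_mono[OF words[OF k W]]]) auto
      then have "cmod (tensor_form p u (\<lambda>l. matrix_word W k *v x l)) \<le>
          (\<Sum>i<CARD('n) ^ p. cmod (u i)) * (\<Prod>l<p. s ^ k * norm (x l))"
        by (rule tensor_form_le)
      also have "\<dots> = Q * (s ^ p) ^ k"
        by (simp add: Q_def prod.distrib power_mult[symmetric] mult.commute mult.left_commute)
      finally show "cmod (tensor_form p u (\<lambda>l. matrix_word W k *v x l)) \<le> Q * (s ^ p) ^ k" .
    qed simp
    then show "cmod e ^ k \<le> Q / cmod (tensor_form p u x) * (s ^ p) ^ k"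
      using nz by (simp add: field_simps)
  qed
qed

lemma mean_pullback_iterate:
  fixes u :: "nat \<Rightarrow> real"
  assumes "j < CARD('n) ^ p"
  shows "(mean_pullback p ^^ k) u j = (\<Sum>i<CARD('n) ^ p. (mean_power p ^\<^sub>m k) $$ (i, j) * u i)"
  using assms
proof (induction k arbitrary: j)
  case 0
  have "(\<Sum>i<CARD('n) ^ p. (mean_power p ^\<^sub>m 0) $$ (i, j) * u i) = (\<Sum>i<CARD('n) ^ p. if i = j then u i else 0)"
    using 0 by (intro sum.cong) auto
  also have "\<dots> = u j" using 0 by simp
  finally show ?case by simp
next
  case (Suc k)
  let ?n = "CARD('n) ^ p"
  have E: "mean_power p \<in> carrier_mat ?n ?n" "mean_power p ^\<^sub>m k \<in> carrier_mat ?n ?n" by (simp_all del: One_nat_def)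
  have "(mean_pullback p ^^ Suc k) u j = (\<Sum>i<?n. mean_power p $$ (i, j) * (\<Sum>l<?n. (mean_power p ^\<^sub>m k) $$ (l, i) * u l))"
    by (simp add: mean_pullback_def Suc.IH)
  also have "\<dots> = (\<Sum>l<?n. \<Sum>i<?n. mean_power p $$ (i, j) * ((mean_power p ^\<^sub>m k) $$ (l, i) * u l))"
    unfolding sum_distrib_left by (rule sum.swap)
  also have "\<dots> = (\<Sum>l<?n. (mean_power p ^\<^sub>m Suc k) $$ (l, j) * u l)"
    using Suc.prems E
    by (intro sum.cong)
      (auto simp: scalar_prod_def lessThan_atLeast0 sum_distrib_left mult_ac intro!: sum.cong)
  finally show ?case .
qed

text \<open>Let \<open>h k x\<close> be the mean of \<open>\<Sum>a. y\<^sub>a^p\<close> at \<open>y = A\<^sub>k \<cdots> A\<^sub>1 x\<close> for independent copies \<open>A\<^sub>i\<close> of \<open>A\<close>; it is a linear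
function of the tensor power of \<open>x\<close>, computed by iterating \<^term>\<open>mean_pullback p\<close>. The form
\<open>f x = (\<Sum>k<n. h k x / S ^ k)\<close> with \<open>S = s ^ p\<close> telescopes under averaging:
\<open>E f(A x) = S * (f x - h 0 x + h n x / S ^ n)\<close>. The bound on matrix powers makes \<open>h n x \<le> S ^ n * h 0 x\<close> for a
suitable \<open>n\<close>. Evenness of \<open>p\<close> makes the starting form convex and nonnegative.\<close>

lemma averaged_norm:
  assumes p: "even p" "0 < p" and s: "0 < s"
    and sr: "spectral_radius (map_mat complex_of_real (mean_power p)) < s ^ p"
  shows "\<exists>N. seminorm N \<and> (\<forall>x. x \<noteq> 0 \<longrightarrow> 0 < N x) \<and>
    (\<forall>x. integrable P (\<lambda>\<omega>. N (A \<omega> *v x) ^ p) \<and> (\<integral>\<omega>. N (A \<omega> *v x) ^ p \<partial>P) \<le> s ^ p * N x ^ p)"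
proof -
  let ?n = "CARD('n) ^ p"
  define S where "S = s ^ p"
  have S: "0 < S" using s by (simp add: S_def)
  have "\<forall>a :: 'n. \<exists>J<?n. \<forall>x :: real^'n. tensor p (\<lambda>_. x) J = x $ a ^ p"
    using tensor_diagonal_power by blast
  then obtain J :: "'n \<Rightarrow> nat" where J: "\<And>a. J a < ?n"
      "\<And>a (x :: real^'n). tensor p (\<lambda>_. x) (J a) = x $ a ^ p"
    by metis
  define u where "u i = (\<Sum>a\<in>(UNIV :: 'n set). if i = J a then 1 else 0 :: real)" for i
  define h where "h k x = tensor_form p ((mean_pullback p ^^ k) u) (\<lambda>_. x)" for k and x :: "real^'n"
  have h0: "h 0 x = (\<Sum>a\<in>UNIV. x $ a ^ p)" for x
  proof -
    have "h 0 x = (\<Sum>i<?n. \<Sum>a\<in>UNIV. if i = J a then tensor p (\<lambda>_. x) i else 0)"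
      by (auto simp: h_def tensor_form_def u_def sum_distrib_left intro!: sum.cong)
    also have "\<dots> = (\<Sum>a\<in>UNIV. \<Sum>i<?n. if i = J a then tensor p (\<lambda>_. x) i else 0)"
      by (rule sum.swap)
    also have "\<dots> = (\<Sum>a\<in>UNIV. x $ a ^ p)" using J by (intro sum.cong) auto
    finally show ?thesis .
  qed
  have h_int: "integrable P (\<lambda>\<omega>. h k (A \<omega> *v x))"
    and h_Suc: "(\<integral>\<omega>. h k (A \<omega> *v x) \<partial>P) = h (Suc k) x" for k x
    unfolding h_def using tensor_form_expectation[of p "(mean_pullback p ^^ k) u" "\<lambda>_. x"] by simp_all
  have h_scale: "h k (c *\<^sub>R x) = \<bar>c\<bar> ^ p * h k x" for k c x
    using p(1) by (simp add: h_def tensor_form_def tensor_scale sum_distrib_left power_even_abs mult.assoc)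
  have h_nonneg: "0 \<le> h k x" for k x
  proof (induction k arbitrary: x)
    case 0 show ?case unfolding h0 using p(1) by (intro sum_nonneg) (simp add: zero_le_even_power)
  next
    case (Suc k)
    show ?case unfolding h_Suc[symmetric] by (rule Bochner_Integration.integral_nonneg) (rule Suc)
  qed
  have h_convex: "h k ((1 - t) *\<^sub>R x + t *\<^sub>R y) \<le> (1 - t) * h k x + t * h k y"
    if t: "0 < t" "t < 1" for k t x y
  proof (induction k arbitrary: x y)
    case 0
    have "((1 - t) * x $ a + t * y $ a) ^ p \<le> (1 - t) * x $ a ^ p + t * y $ a ^ p" for a
      using convex_onD[OF convex_power_even[OF p(1)], of t "x $ a" "y $ a"] t by simp
    then have "(\<Sum>a\<in>UNIV. ((1 - t) * x $ a + t * y $ a) ^ p) \<le>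
        (\<Sum>a\<in>UNIV. (1 - t) * x $ a ^ p + t * y $ a ^ p)" by (rule sum_mono)
    then show ?case unfolding h0 by (simp add: sum.distrib sum_distrib_left)
  next
    case (Suc k)
    have "h (Suc k) ((1 - t) *\<^sub>R x + t *\<^sub>R y) =
        (\<integral>\<omega>. h k ((1 - t) *\<^sub>R (A \<omega> *v x) + t *\<^sub>R (A \<omega> *v y)) \<partial>P)"
      unfolding h_Suc[symmetric] by (simp add: matrix_vector_right_distrib matrix_vector_mult_scaleR)
    also have "\<dots> \<le> (\<integral>\<omega>. (1 - t) * h k (A \<omega> *v x) + t * h k (A \<omega> *v y) \<partial>P)"
    proof (rule integral_mono)
      show "integrable P (\<lambda>\<omega>. h k ((1 - t) *\<^sub>R (A \<omega> *v x) + t *\<^sub>R (A \<omega> *v y)))"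
        using h_int[of k "(1 - t) *\<^sub>R x + t *\<^sub>R y"]
        by (simp add: matrix_vector_right_distrib matrix_vector_mult_scaleR)
      show "integrable P (\<lambda>\<omega>. (1 - t) * h k (A \<omega> *v x) + t * h k (A \<omega> *v y))"
        by (intro Bochner_Integration.integrable_add integrable_mult_right h_int)
    qed (rule Suc)
    also have "\<dots> = (1 - t) * h (Suc k) x + t * h (Suc k) y"
      by (subst Bochner_Integration.integral_add) (auto simp: h_int h_Suc)
    finally show ?case .
  qed
  have tensor_le_h0: "\<bar>tensor p (\<lambda>_. x) i\<bar> \<le> h 0 x" for x :: "real^'n" and i
  proof -
    obtain a where a: "\<And>b. \<bar>x $ b\<bar> \<le> \<bar>x $ a\<bar>"
    proof -
      have "Max (range (\<lambda>b. \<bar>x $ b\<bar>)) \<in> range (\<lambda>b. \<bar>x $ b\<bar>)" by (rule Max_in) auto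
      then obtain a where "Max (range (\<lambda>b. \<bar>x $ b\<bar>)) = \<bar>x $ a\<bar>" by blast
      then have "\<bar>x $ b\<bar> \<le> \<bar>x $ a\<bar>" for b using Max_ge[of "range (\<lambda>b. \<bar>x $ b\<bar>)" "\<bar>x $ b\<bar>"] by simp
      then show ?thesis by (rule that)
    qed
    have "\<bar>tensor p (\<lambda>_. x) i\<bar> \<le> \<bar>x $ a\<bar> ^ p" by (rule tensor_diagonal_le[OF a])
    also have "\<dots> = x $ a ^ p" using p(1) by (rule power_even_abs)
    also have "\<dots> \<le> h 0 x" unfolding h0
      using p(1) by (intro member_le_sum) (auto simp: zero_le_even_power)
    finally show ?thesis .
  qed
  \<comment> \<open>A positive number strictly between the spectral radius and \<open>S\<close>.\<close>
  define t where "t = (max 0 (spectral_radius (map_mat complex_of_real (mean_power p))) + S) / 2"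
  have t: "0 < t" "t < S" "spectral_radius (map_mat complex_of_real (mean_power p)) < t"
    using sr S by (auto simp: t_def S_def)
  obtain c where c: "\<And>k i j. i < ?n \<Longrightarrow> j < ?n \<Longrightarrow> \<bar>(mean_power p ^\<^sub>m k) $$ (i, j)\<bar> \<le> c * t ^ k"
    using spectral_radius_power_bound[OF mean_power_carrier _ t(1,3)] by auto
  define Q where "Q = (\<Sum>j<?n. \<Sum>i<?n. c * \<bar>u i\<bar>)"
  have h_bound: "h k x \<le> Q * t ^ k * h 0 x" for k x
  proof -
    have coeff: "\<bar>(mean_pullback p ^^ k) u j\<bar> \<le> (\<Sum>i<?n. c * \<bar>u i\<bar>) * t ^ k" if "j < ?n" for j
    proof -
      have "\<bar>(mean_pullback p ^^ k) u j\<bar> \<le> (\<Sum>i<?n. \<bar>(mean_power p ^\<^sub>m k) $$ (i, j) * u i\<bar>)"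
        unfolding mean_pullback_iterate[OF that] by (rule sum_abs)
      also have "\<dots> \<le> (\<Sum>i<?n. c * t ^ k * \<bar>u i\<bar>)"
        using c that by (intro sum_mono) (auto simp: abs_mult intro!: mult_right_mono)
      finally show ?thesis by (simp add: sum_distrib_left sum_distrib_right mult_ac)
    qed
    have "h k x \<le> (\<Sum>j<?n. \<bar>tensor p (\<lambda>_. x) j * (mean_pullback p ^^ k) u j\<bar>)"
      unfolding h_def tensor_form_def by (intro sum_mono) auto
    also have "\<dots> \<le> (\<Sum>j<?n. h 0 x * ((\<Sum>i<?n. c * \<bar>u i\<bar>) * t ^ k))"
      unfolding abs_mult using coeff tensor_le_h0 h_nonneg by (intro sum_mono mult_mono) auto
    also have "\<dots> = Q * t ^ k * h 0 x"
      by (simp add: Q_def sum_distrib_right sum_distrib_left mult_ac)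
    finally show ?thesis .
  qed
  have "\<exists>n>0. Q * t ^ n \<le> S ^ n"
  proof -
    have "0 < 1 / (\<bar>Q\<bar> + 1)" "t / S < 1" using t S by (auto simp: divide_simps)
    then obtain n where n: "(t / S) ^ n < 1 / (\<bar>Q\<bar> + 1)" using real_arch_pow_inv by blast
    have "1 / (\<bar>Q\<bar> + 1) \<le> 1" by simp
    then have "n \<noteq> 0" using n by (intro notI) simp
    have "Q * (t / S) ^ n \<le> (\<bar>Q\<bar> + 1) * (t / S) ^ n" using t S by (intro mult_right_mono) auto
    also have "\<dots> \<le> 1" using n by (simp add: field_simps)
    finally have "Q * t ^ n \<le> S ^ n" using S by (simp add: power_divide pos_divide_le_eq)
    then show ?thesis using \<open>n \<noteq> 0\<close> by blast
  qed
  then obtain n where n: "0 < n" "Q * t ^ n \<le> S ^ n" by blast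
  define f where "f x = (\<Sum>k<n. h k x / S ^ k)" for x
  have f_pos: "0 < f x" if x: "x \<noteq> 0" for x
  proof -
    obtain a where "x $ a \<noteq> 0" using x by (auto simp: Finite_Cartesian_Product.vec_eq_iff)
    then have "0 < x $ a ^ p" using p(1) by (simp add: zero_less_power_eq)
    then have "0 < h 0 x" unfolding h0
      using p(1) by (intro sum_pos2[of _ a]) (auto simp: zero_le_even_power)
    also have "h 0 x = h 0 x / S ^ 0" by simp
    also have "\<dots> \<le> f x" unfolding f_def
      using n(1) h_nonneg S by (intro member_le_sum) auto
    finally show ?thesis .
  qed
  have f_scale: "f (c *\<^sub>R x) = \<bar>c\<bar> ^ p * f x" for c x
    by (simp add: f_def h_scale sum_distrib_left)
  have f_convex: "convex_on UNIV f"
  proof (rule convex_onI)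
    fix a :: real and x y :: "real^'n" assume a: "0 < a" "a < 1"
    have "f ((1 - a) *\<^sub>R x + a *\<^sub>R y) \<le> (\<Sum>k<n. ((1 - a) * h k x + a * h k y) / S ^ k)"
      unfolding f_def using h_convex[OF a] S by (intro sum_mono divide_right_mono) auto
    also have "\<dots> = (1 - a) * f x + a * f y"
      by (simp add: f_def sum_distrib_left sum.distrib add_divide_distrib)
    finally show "f ((1 - a) *\<^sub>R x + a *\<^sub>R y) \<le> (1 - a) * f x + a * f y" .
  qed simp
  have f_int: "integrable P (\<lambda>\<omega>. f (A \<omega> *v x))" for x
    unfolding f_def by (intro Bochner_Integration.integrable_sum integrable_divide h_int)
  have f_avg: "(\<integral>\<omega>. f (A \<omega> *v x) \<partial>P) \<le> S * f x" for x
  proof -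
    have "(\<integral>\<omega>. f (A \<omega> *v x) \<partial>P) = (\<Sum>k<n. h (Suc k) x / S ^ k)"
      unfolding f_def by (subst Bochner_Integration.integral_sum) (auto simp: h_int h_Suc)
    also have "\<dots> = S * (\<Sum>k<n. h (Suc k) x / S ^ Suc k)"
      using S by (simp add: sum_distrib_left)
    also have "(\<Sum>k<n. h (Suc k) x / S ^ Suc k) = f x + h n x / S ^ n - h 0 x"
      using sum.lessThan_Suc_shift[of "\<lambda>k. h k x / S ^ k" n]
      by (simp add: f_def)
    also have "S * (f x + h n x / S ^ n - h 0 x) \<le> S * f x"
    proof -
      have "h n x \<le> S ^ n * h 0 x"
        using h_bound[of n x] mult_right_mono[OF n(2) h_nonneg[of 0 x]] by linarith
      then have "h n x / S ^ n \<le> h 0 x" using S by (simp add: field_simps)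
      then show ?thesis using S by (intro mult_left_mono) auto
    qed
    finally show ?thesis .
  qed
  have f_nonneg: "0 \<le> f x" for x
    unfolding f_def using h_nonneg S by (intro sum_nonneg) auto
  define N where "N x = root p (f x)" for x
  have N_pow: "N x ^ p = f x" for x using p f_nonneg by (simp add: N_def)
  have "seminorm N"
    unfolding N_def by (rule convex_homogeneous_root_seminorm[OF p(2) f_convex f_scale f_pos])
  moreover have "0 < N x" if "x \<noteq> 0" for x
    unfolding N_def by (rule real_root_gt_zero[OF p(2) f_pos[OF that]])
  moreover have "integrable P (\<lambda>\<omega>. N (A \<omega> *v x) ^ p)" for x
    unfolding N_pow by (rule f_int)
  moreover have "(\<integral>\<omega>. N (A \<omega> *v x) ^ p \<partial>P) \<le> s ^ p * N x ^ p" for x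
    unfolding N_pow S_def[symmetric] by (rule f_avg)
  ultimately show ?thesis by blast
qed

text \<open>If all matrices of \<open>M\<close> within distance \<open>d\<close> of \<open>X\<close> expanded \<open>N k\<close> at \<open>x\<close> by more than \<open>r + d\<close>, then the mean would be
at least \<open>m * (r + d) ^ q k\<close> times \<open>N k x ^ q k\<close>, where \<open>m\<close> is the probability of that neighbourhood. As \<open>m\<close> does
not depend on \<open>k\<close> or \<open>x\<close>, this contradicts the bound by \<open>r ^ q k\<close> once \<open>(r / (r + d)) ^ k < m\<close>.\<close>

lemma averaged_norms_approximate:
  fixes N :: "nat \<Rightarrow> real^'n \<Rightarrow> real"
  assumes N: "\<And>k. seminorm (N k)" "\<And>k x. x \<noteq> 0 \<Longrightarrow> 0 < N k x"
    and int: "\<And>k x. integrable P (\<lambda>\<omega>. N k (A \<omega> *v x) ^ q k)"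
    and avg: "\<And>k x. (\<integral>\<omega>. N k (A \<omega> *v x) ^ q k \<partial>P) \<le> r ^ q k * N k x ^ q k"
    and q: "\<And>k. k < q k" and r: "0 \<le> r" and X: "X \<in> M" and d: "0 < d"
  shows "eventually (\<lambda>k. \<forall>x. \<exists>X'\<in>M.
    norm (X - X') < d \<and> N k (X' *v x) \<le> (r + d) * N k x) sequentially"
proof -
  let ?E = "{\<omega> \<in> space P. norm (X - A \<omega>) < d}"
  note [measurable] = A_measurable
  have E: "?E \<in> sets P" by measurable
  define m where "m = prob ?E"
  have m: "0 < m" using A_near[OF X d] by (simp add: m_def)
  have ratio: "0 \<le> r / (r + d)" "r / (r + d) < 1" using r d by auto
  then have "(\<lambda>k. (r / (r + d)) ^ k) \<longlonglongrightarrow> 0" by (rule LIMSEQ_realpow_zero)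
  then have "eventually (\<lambda>k. (r / (r + d)) ^ k < m) sequentially"
    using m by (rule order_tendstoD)
  then show ?thesis
  proof eventually_elim
    case (elim k)
    show ?case
    proof (rule allI, rule ccontr)
      fix x
      assume neg: "\<not> (\<exists>X'\<in>M. norm (X - X') < d \<and> N k (X' *v x) \<le> (r + d) * N k x)"
      have "x \<noteq> 0"
      proof
        assume "x = 0"
        then have "N k (X *v x) \<le> (r + d) * N k x" by (simp add: seminorm_zero[OF N(1)])
        then show False using neg X d by auto
      qed
      define b where "b = N k x"
      have b: "0 < b" using N(2)[OF \<open>x \<noteq> 0\<close>] by (simp add: b_def)
      have "m * ((r + d) * b) ^ q k = (\<integral>\<omega>. indicator ?E \<omega> * ((r + d) * b) ^ q k \<partial>P)"
        using E by (simp add: m_def)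
      also have "\<dots> \<le> (\<integral>\<omega>. N k (A \<omega> *v x) ^ q k \<partial>P)"
      proof (rule integral_mono_AE)
        show "integrable P (\<lambda>\<omega>. indicator ?E \<omega> * ((r + d) * b) ^ q k)"
          using E by (intro integrable_mult_left integrable_real_indicator) (auto simp: emeasure_eq_measure)
        show "integrable P (\<lambda>\<omega>. N k (A \<omega> *v x) ^ q k)" by (rule int)
        show "AE \<omega> in P. indicator ?E \<omega> * ((r + d) * b) ^ q k \<le> N k (A \<omega> *v x) ^ q k"
          using A_in_M
        proof eventually_elim
          case (elim \<omega>)
          show ?case
          proof (cases "\<omega> \<in> ?E")
            case True
            then have "(r + d) * b \<le> N k (A \<omega> *v x)" using neg elim by (force simp: b_def)
            then show ?thesis using True r d b by (simp add: power_mono)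
          next
            case False
            then show ?thesis by (simp add: seminorm_nonneg[OF N(1)])
          qed
        qed
      qed
      also have "\<dots> \<le> r ^ q k * b ^ q k" unfolding b_def by (rule avg)
      finally have "m * (r + d) ^ q k * b ^ q k \<le> r ^ q k * b ^ q k"
        by (simp add: power_mult_distrib mult.assoc)
      then have "m * (r + d) ^ q k \<le> r ^ q k" using b by simp
      then have "m \<le> (r / (r + d)) ^ q k" using r d by (simp add: power_divide pos_le_divide_eq)
      also have "\<dots> \<le> (r / (r + d)) ^ k" using ratio q[of k] by (intro power_decreasing) auto
      finally show False using elim by simp
    qed
  qed
qed

lemma word_growth:
  assumes r: "0 < r" "r < s"
    and ev: "eventually (\<lambda>p. spectral_radius (map_mat complex_of_real (mean_power p)) < r ^ p) sequentially"
  shows "\<exists>D>0. \<forall>k W. (\<forall>i\<in>{1..k}. W i \<in> M) \<longrightarrow> norm (matrix_word W k) \<le> D * s ^ k"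
proof -
  obtain p0 where p0: "\<And>p. p0 \<le> p \<Longrightarrow> spectral_radius (map_mat complex_of_real (mean_power p)) < r ^ p"
    using ev by (auto simp: eventually_sequentially)
  define q where "q k = 2 * (k + p0 + 1)" for k :: nat
  have "\<forall>k. \<exists>N. seminorm N \<and> (\<forall>x. x \<noteq> 0 \<longrightarrow> 0 < N x) \<and>
    (\<forall>x. integrable P (\<lambda>\<omega>. N (A \<omega> *v x) ^ q k) \<and>
      (\<integral>\<omega>. N (A \<omega> *v x) ^ q k \<partial>P) \<le> r ^ q k * N x ^ q k)"
    by (intro allI averaged_norm r p0) (auto simp: q_def)
  from choice[OF this] obtain N where N: "\<And>k. seminorm (N k)" "\<And>k x. x \<noteq> 0 \<Longrightarrow> 0 < N k x"
    "\<And>k x. integrable P (\<lambda>\<omega>. N k (A \<omega> *v x) ^ q k)"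
    "\<And>k x. (\<integral>\<omega>. N k (A \<omega> *v x) ^ q k \<partial>P) \<le> r ^ q k * N k x ^ q k"
    by blast
  have approx: "eventually (\<lambda>k. \<forall>x. \<exists>X'\<in>M.
      norm (X - X') < d \<and> N k (X' *v x) \<le> (r + d) * N k x) sequentially"
    if "X \<in> M" "0 < d" for X d
    by (rule averaged_norms_approximate[OF N _ _ that]) (use r in \<open>auto simp: q_def\<close>)
  have "\<exists>g c C. 0 < c \<and> (\<forall>x\<in>UNIV. c * norm x \<le> g x \<and> g x \<le> C * norm x) \<and>
      (\<forall>x\<in>UNIV. \<forall>y\<in>UNIV. g (x + y) \<le> g x + g y) \<and> (\<forall>X\<in>M. \<forall>x\<in>UNIV. g (X *v x) \<le> s * g x)"
    by (rule invariant_subspace_gauge[OF N(1,2) M_bounded less_imp_le[OF r(1)] r(2) approx]) auto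
  then obtain g c C where g: "0 < c" "\<And>x :: real^'n. c * norm x \<le> g x" "\<And>x. g x \<le> C * norm x"
    "\<And>X x. X \<in> M \<Longrightarrow> g (X *v x) \<le> s * g x"
    by (meson UNIV_I)
  define D where "D = real (CARD('n) * CARD('n)) * (\<bar>C\<bar> / c) + 1"
  have word: "norm (matrix_word W k) \<le> real (CARD('n) * CARD('n)) * (\<bar>C\<bar> / c * s ^ k)"
    if W: "\<forall>i\<in>{1..k}. W i \<in> M" for k W
  proof (rule norm_matrix_le_columns)
    fix x :: "real^'n"
    have "c * norm (matrix_word W k *v x) \<le> g (matrix_word W k *v x)" by (rule g(2))
    also have "\<dots> \<le> s ^ k * g x" 
      by (rule gauge_matrix_word[where M = M and g = g]) (use g(4) r W in auto)
    also have "\<dots> \<le> s ^ k * (\<bar>C\<bar> * norm x)"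
      using r order_trans[OF g(3)[of x] mult_right_mono[OF abs_ge_self[of C] norm_ge_zero[of x]]]
      by (intro mult_left_mono) auto
    finally show "norm (matrix_word W k *v x) \<le> \<bar>C\<bar> / c * s ^ k * norm x"
      using g(1) by (simp add: field_simps)
  qed
  have "real (CARD('n) * CARD('n)) * (\<bar>C\<bar> / c * s ^ k) \<le> D * s ^ k" for k
    unfolding D_def distrib_right mult.assoc using r by simp
  with word have "norm (matrix_word W k) \<le> D * s ^ k" if "\<forall>i\<in>{1..k}. W i \<in> M" for k W
    using that order_trans by blast
  moreover have "0 < D"
    unfolding D_def using g(1) by (intro add_nonneg_pos mult_nonneg_nonneg) auto
  ultimately show ?thesis by blast
qed

section \<open>The limit formula\<close>

abbreviation "mean_radius p \<equiv> spectral_radius (map_mat complex_of_real (mean_power p))"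

lemma mean_radius_eigenvalue: "\<exists>e. eigenvalue (map_mat complex_of_real (mean_power p)) e \<and> mean_radius p = cmod e"
proof -
  have "map_mat complex_of_real (mean_power p) \<in> carrier_mat (CARD('n) ^ p) (CARD('n) ^ p)" by simp
  from spectral_radius_mem_max(1)[OF this] show ?thesis by (auto simp: spectrum_def)
qed

lemma joint_spectral_radius_nonneg: "0 \<le> joint_spectral_radius M"
proof -
  obtain X where X: "X \<in> M" using M_nonempty by blast
  have "0 \<le> (SUP W\<in>{W. \<forall>i\<in>{1..k}. W i \<in> M}. ereal (root k (norm (matrix_word W k))))" for k
  proof (rule SUP_upper2)
    show "(\<lambda>_. X) \<in> {W. \<forall>i\<in>{1..k}. W i \<in> M}" using X by simp
    show "0 \<le> ereal (root k (norm (matrix_word (\<lambda>_. X) k)))" by (simp add: real_root_ge_zero)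
  qed
  then show ?thesis unfolding joint_spectral_radius_def
    by (intro le_Limsup always_eventually allI sequentially_bot)
qed

lemma limsup_le_joint_spectral_radius:
  "limsup (\<lambda>p. ereal (root p (mean_radius p))) \<le> joint_spectral_radius M"
proof (rule ccontr)
  assume "\<not> ?thesis"
  then have "joint_spectral_radius M < limsup (\<lambda>p. ereal (root p (mean_radius p)))" by (rule not_le_imp_less)
  from ereal_dense2[OF this] obtain s where s: "joint_spectral_radius M < ereal s"
      "ereal s < limsup (\<lambda>p. ereal (root p (mean_radius p)))"
    by blast
  have "0 < ereal s" using joint_spectral_radius_nonneg s(1) by (rule order_le_less_trans)
  then have "0 < s" by simp
  have "eventually (\<lambda>k. (SUP W\<in>{W. \<forall>i\<in>{1..k}. W i \<in> M}.
      ereal (root k (norm (matrix_word W k)))) < ereal s) sequentially"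
    using s(1) unfolding joint_spectral_radius_def by (rule Limsup_lessD)
  then obtain k0 where k0: "\<And>k. k0 \<le> k \<Longrightarrow> (SUP W\<in>{W. \<forall>i\<in>{1..k}. W i \<in> M}.
      ereal (root k (norm (matrix_word W k)))) < ereal s"
    by (auto simp: eventually_sequentially)
  have words: "norm (matrix_word W k) \<le> s ^ k"
    if k: "max k0 1 \<le> k" and W: "\<And>i. i \<in> {1..k} \<Longrightarrow> W i \<in> M" for k W
  proof -
    have "ereal (root k (norm (matrix_word W k))) \<le>
        (SUP W\<in>{W. \<forall>i\<in>{1..k}. W i \<in> M}. ereal (root k (norm (matrix_word W k))))"
      using W by (intro SUP_upper) simp
    also have "\<dots> < ereal s" using k by (intro k0) simp
    finally have "root k (norm (matrix_word W k)) ^ k \<le> s ^ k"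
      by (intro power_mono) (auto simp: real_root_ge_zero)
    then show ?thesis using k by simp
  qed
  have "root p (mean_radius p) \<le> s" if p: "1 \<le> p" for p
  proof -
    obtain e where e: "eigenvalue (map_mat complex_of_real (mean_power p)) e" "mean_radius p = cmod e"
      using mean_radius_eigenvalue by blast
    have "mean_radius p \<le> s ^ p"
      unfolding e(2) using e(1) \<open>0 < s\<close> words by (rule eigenvalue_le)
    then have "root p (mean_radius p) \<le> root p (s ^ p)" using p by simp
    then show ?thesis using p \<open>0 < s\<close> by (simp add: real_root_power_cancel)
  qed
  then have "limsup (\<lambda>p. ereal (root p (mean_radius p))) \<le> ereal s"
    by (intro Limsup_bounded eventually_sequentiallyI[of 1]) simp
  with s(2) show False by simp
qed

lemma joint_spectral_radius_le_limsup:
  "joint_spectral_radius M \<le> limsup (\<lambda>p. ereal (root p (mean_radius p)))"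
proof (rule ccontr)
  let ?l = "limsup (\<lambda>p. ereal (root p (mean_radius p)))"
  assume "\<not> ?thesis"
  then have "?l < joint_spectral_radius M" by (rule not_le_imp_less)
  from ereal_dense2[OF this] obtain s where s: "?l < ereal s" "ereal s < joint_spectral_radius M"
    by blast
  from ereal_dense2[OF s(1)] obtain r where r: "?l < ereal r" "ereal r < ereal s"
    by blast
  have mean_radius_nonneg: "0 \<le> mean_radius p" for p using mean_radius_eigenvalue[of p] by auto
  have "0 \<le> ereal (root p (mean_radius p))" for p using mean_radius_nonneg[of p] by (simp add: real_root_ge_zero)
  then have "0 \<le> ?l" by (intro le_Limsup always_eventually allI sequentially_bot)
  then have "0 < ereal r" using r(1) by (rule order_le_less_trans)
  then have "0 < r" by simp
  have "eventually (\<lambda>p. ereal (root p (mean_radius p)) < ereal r) sequentially"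
    using r(1) by (rule Limsup_lessD)
  moreover have "eventually (\<lambda>p::nat. 0 < p) sequentially" by (rule eventually_gt_at_top)
  ultimately have "eventually (\<lambda>p. mean_radius p < r ^ p) sequentially"
  proof eventually_elim
    case (elim p)
    then have "root p (mean_radius p) ^ p < r ^ p"
      using mean_radius_nonneg by (intro power_strict_mono) (auto simp: real_root_ge_zero)
    then show ?case using elim mean_radius_nonneg by simp
  qed
  moreover have "r < s" using r(2) by simp
  ultimately obtain D
    where D: "0 < D" "\<And>k W. (\<forall>i\<in>{1..k}. W i \<in> M) \<Longrightarrow> norm (matrix_word W k) \<le> D * s ^ k"
    using word_growth[OF \<open>0 < r\<close>] by blast
  have "0 < s" using \<open>0 < r\<close> r(2) by simp
  have "(\<lambda>k. root k D * s) \<longlonglongrightarrow> 1 * s"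
    by (intro tendsto_mult LIMSEQ_root_const D tendsto_const)
  then have lim: "(\<lambda>k. ereal (root k D * s)) \<longlonglongrightarrow> ereal s" by simp
  have "joint_spectral_radius M \<le> limsup (\<lambda>k. ereal (root k D * s))"
    unfolding joint_spectral_radius_def
  proof (rule Limsup_mono)
    show "eventually (\<lambda>k. (SUP W\<in>{W. \<forall>i\<in>{1..k}. W i \<in> M}.
        ereal (root k (norm (matrix_word W k)))) \<le> ereal (root k D * s)) sequentially"
      using eventually_gt_at_top[of 0]
    proof eventually_elim
      case (elim k)
      show ?case
      proof (rule SUP_least)
        fix W assume "W \<in> {W. \<forall>i\<in>{1..k}. W i \<in> M}"
        then have "root k (norm (matrix_word W k)) \<le> root k (D * s ^ k)" 
          using elim by (intro real_root_le_mono D(2)) auto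
        also have "\<dots> = root k D * s"
          using elim \<open>0 < s\<close> by (simp add: real_root_mult real_root_power_cancel)
        finally show "ereal (root k (norm (matrix_word W k))) \<le> ereal (root k D * s)" by simp
      qed
    qed
  qed
  also have "\<dots> = ereal s" using lim by (rule lim_imp_Limsup[OF sequentially_bot])
  finally show False using s(2) by simp
qed

end

text \<open>The complement of the support is a union of open null sets, and by the Lindeloef property countably many suffice.\<close>

lemma AE_measure_support:
  fixes \<mu> :: "'a::second_countable_topology measure"
  assumes "sets \<mu> = sets borel"
  shows "AE x in \<mu>. x \<in> measure_support \<mu>"
proof -
  let ?F = "{U. open U \<and> emeasure \<mu> U = 0}"
  obtain G where G: "G \<subseteq> ?F" "countable G" "\<Union>G = \<Union>?F"
    by (rule Lindelof[of ?F]) auto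
  have "(\<Union>U\<in>G. U) \<in> null_sets \<mu>"
  proof (rule null_sets_UN'[OF G(2)])
    fix U assume "U \<in> G"
    then have "open U" "emeasure \<mu> U = 0" using G(1) by auto
    then show "U \<in> null_sets \<mu>" using assms by (auto simp: null_sets_def)
  qed
  then show ?thesis
  proof (rule AE_I')
    show "{x \<in> space \<mu>. x \<notin> measure_support \<mu>} \<subseteq> (\<Union>U\<in>G. U)"
      using G(3) by (auto simp: measure_support_def not_gr_zero)
  qed
qed

theorem mainTheorem6:
  fixes \<mu> \<mu>\<^sub>a \<mu>\<^sub>s :: "(real^'n^'n) measure"
    and P :: "'w measure" and A :: "'w \<Rightarrow> real^'n^'n"
    and N :: nat and p :: "nat \<Rightarrow> real" and M :: "nat \<Rightarrow> real^'n^'n"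
  assumes "prob_space \<mu>" and "sets \<mu> = sets borel"
    and "compact (measure_support \<mu>)"
    and "prob_space P" and "A \<in> borel_measurable P" and "distr P borel A = \<mu>"
    and "lebesgue_decomposition lborel \<mu> \<mu>\<^sub>a \<mu>\<^sub>s"
    and "\<And>i. i \<in> {1..N} \<Longrightarrow> p i > 0"
    and "\<And>B. B \<in> sets borel \<Longrightarrow>
           emeasure \<mu>\<^sub>s B = (\<Sum>i=1..N. ennreal (p i) * emeasure (return borel (M i)) B)"
  shows "joint_spectral_radius (measure_support \<mu>) =
    limsup (\<lambda>q. ereal (root q
      (spectral_radius (map_mat complex_of_real (expected_kronecker_power P A q)))))"
proof -
  obtain B where B: "\<And>X. X \<in> measure_support \<mu> \<Longrightarrow> norm X \<le> B"
    using compact_imp_bounded[OF assms(3)] unfolding bounded_iff by blast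
  interpret prob_space P by (rule assms(4))
  interpret bounded_random_matrix P A "measure_support \<mu>" B
  proof
    show "A \<in> borel_measurable P" by (rule assms(5))
    show "norm X \<le> B" if "X \<in> measure_support \<mu>" for X using that by (rule B)
    have "AE X in distr P borel A. X \<in> measure_support \<mu>"
      unfolding assms(6) by (rule AE_measure_support[OF assms(2)])
    then show "AE \<omega> in P. A \<omega> \<in> measure_support \<mu>"
      by (rule AE_distrD[OF assms(5)])
    show "0 < prob {\<omega> \<in> space P. norm (X - A \<omega>) < e}"
      if X: "X \<in> measure_support \<mu>" and e: "0 < e" for X e
    proof -
      have "0 < emeasure \<mu> (ball X e)"
        using X e unfolding measure_support_def by simp
      also have "emeasure \<mu> (ball X e) = emeasure P (A -` ball X e \<inter> space P)"
        unfolding assms(6)[symmetric] by (rule emeasure_distr[OF assms(5)]) simp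
      also have "A -` ball X e \<inter> space P = {\<omega> \<in> space P. norm (X - A \<omega>) < e}"
        by (auto simp: dist_norm)
      finally show ?thesis by (simp add: emeasure_eq_measure)
    qed
  qed
  show ?thesis
    by (rule antisym[OF joint_spectral_radius_le_limsup limsup_le_joint_spectral_radius])
qed

end
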